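(* There exist infinitely many pairs of twisted links such that for each pair the two twisted links are distinct but their double coverings are equivalent as virtual links. Precisely: for each positive integer $n$ there exists a pair of twisted link diagrams $(D(n)^x,D(n)^y)$ such that (1) $D(n)^x$ and $D(n)^y$ are not equivalent as twisted links, neither as ordered nor as unordered twisted links; (2) their double covering diagrams $\widetilde{D}(n)^x$ and $\widetilde{D}(n)^y$ are equivalent as virtual links, both as partitioned and as unpartitioned virtual links; (3) for $n\neq n'$, the twisted links represented by $D(n)^x$ and $D(n)^y$ are different from those represented by $D(n')^x$ and $D(n')^y$ (that is, neither of $D(n)^x,D(n)^y$ is equivalent, as a twisted link, to either of $D(n')^x,D(n')^y$).
   Context: **Twisted and virtual link diagrams.** A twisted link diagram $D=D_1\cup\cdots\cup D_m$ is a finite collection of oriented closed curves (components) generically immersed in the oriented plane $\mathbb{R}^2$, whose only multiple points are finitely many transverse double points. Each double point is either a classical crossing (with over/under information) or a virtual crossing (no over/under information). In addition there are finitely many bars, a bar being a short segment crossing an arc of the diagram transversally at a point that is not a crossing. A virtual link diagram is a twisted link diagram without bars. Twisted link diagrams are ordered by default: components are numbered $1,\dots,m$. **Equivalence.** The generalized Reidemeister moves (with all orientations of strands) are: the classical Reidemeister moves R1, R2, R3; the moves V1, V2, V3, which are R1, R2, R3 with all crossings virtual; V4, in which an arc having two consecutive virtual crossings is moved across a classical crossing. The extended Reidemeister moves are these together with: T1, sliding a bar along its arc through a virtual crossing; T2, deleting or inserting two consecutive bars on an arc; T3, relating the following two tangles in a disk with four boundary ends NW, NE, SW, SE: (i)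 a single classical crossing of a strand SW–NE and a strand SE–NW, with one bar on each of the four ends and the strand SW–NE over (resp. under); (ii) no bars, and, stacked vertically, a virtual crossing of the two upper ends, one classical crossing, and a virtual crossing of the two lower ends, so that the strands again join SW to NE and SE to NW, with the strand SW–NE now under (resp. over) at the classical crossing. Two virtual (resp. twisted) link diagrams are equivalent as virtual (resp. twisted) links if related by a finite sequence of isotopies of $\mathbb{R}^2$ and generalized (resp. extended) Reidemeister moves. A twisted link is an equivalence class of twisted link diagrams. Equivalence as ordered twisted links requires the numbering of components to be respected (this is the default); equivalence as unordered twisted links ignores the numbering. A virtual link diagram is partitioned with $\{1,\dots,m\}$ if each component is labeled by an integer in $\{1,\dots,m\}$ (several components may share a label); equivalence as partitioned virtual links must respect the labels, and equivalence as unpartitioned virtual links ignores them. **Double covering diagram.** Let $D=D_1\cup\cdots\cup D_m$ be a twisted link diagram. Move $D$ by an isotopy of $\mathbb{R}^2$ into $\{(x,y): x>0\}$ so that the $y$-coordinates of all classical crossings, virtual crossings and bars are distinct and are not critical values of the height function $y$ on the underlying immersed curves. Let $s(D)\subset\{(x,y):x<0\}$ be the diagram obtained from $D$ by reflection in the $y$-axis followed by switching over/under at all classical crossings (orientations being carried by the reflection). For each bar of $D$ and the corresponding bar of $s(D)$, consider the horizontal segment joining them and a thin regular neighborhood $N$ of it; $N\cap(s(D)\cup D)$ consists of vertical segments, the leftmost and rightmost of which carry the two bars. Remove the two bars, cut these two vertical segments there, and reconnect by two arcs in $N$, one joining the lower end of the left cut segment to the upper end of the right cut segment, the other joining the upper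 end of the left one to the lower end of the right one; the two arcs cross each other once and each crosses every intermediate vertical segment in $N$ once, and all these crossings are virtual. Doing this for all bars gives a virtual link diagram $\widetilde D=\widetilde D_1\cup\cdots\cup\widetilde D_m$, called a double covering diagram of $D$; it is well defined up to isotopies of $\mathbb{R}^2$ and moves V1–V4. Here $\widetilde D_i$ is the part coming from $D_i$ and $s(D_i)$ (it has two components if the number of bars on $D_i$ is even and one if odd), and $\widetilde D$ is partitioned by giving the components of $\widetilde D_i$ the label $i$. The virtual link represented by $\widetilde D$ is the double covering of the twisted link represented by $D$. *)

theory Defs
  imports Main
begin

section \<open>Labelled oriented diagrams in the plane\<close>

text \<open>
  Diagrams are written in general position with respect to the height function $y$ on the plane:
  the crossings, the bars and the critical points (minima and maxima) of the height function on
  the underlying curves have distinct heights.  Such a diagram, up to isotopies of the plane that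
  keep it in general position, is the list of its singular levels read from bottom to top, each
  given by its kind and by the number of strands to the left of it.  Strands are counted from
  the left starting with 0.  Isotopies that pass through non-general positions are
  generated by the relation \<open>isotopy_move\<close> below.

  A strand carries the label of its component and its direction (\<open>True\<close> for upwards).
\<close>

type_synonym 'l strand = "'l \<times> bool"

text \<open>
  A crossing joins its SW end to NE and its SE end to NW.  \<open>Over\<close> and \<open>Under\<close> are the classical
  crossings in which the strand from SW to NE runs over, resp. under, the other strand.
\<close>

datatype crossing = Over | Under | Virtual

text \<open>
  \<open>Cup x d\<close> is a minimum on a curve with label \<open>x\<close>; its left branch is directed upwards iff \<open>d\<close>
  holds.  \<open>Cap\<close> is a maximum.
\<close>

datatype 'l piece = Cup 'l bool | Cap | Cross crossing | Bar

type_synonym 'l word = "(nat \<times> 'l piece) list"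

fun ends_below :: "'l piece \<Rightarrow> nat" where
  "ends_below (Cup x d) = 0"
| "ends_below Cap = 2"
| "ends_below (Cross c) = 2"
| "ends_below Bar = 1"

fun ends_above :: "'l piece \<Rightarrow> nat" where
  "ends_above (Cup x d) = 2"
| "ends_above Cap = 0"
| "ends_above (Cross c) = 2"
| "ends_above Bar = 1"

text \<open>The strands just above a singular level, given those just below it; \<open>None\<close> if the level
  does not fit, in particular if a maximum would join strands of different labels or of
  incompatible directions.\<close>

fun pass :: "'l strand list \<Rightarrow> nat \<times> 'l piece \<Rightarrow> 'l strand list option" where
  "pass S (i, Cup x d) =
     (if i \<le> length S then Some (take i S @ [(x, d), (x, \<not> d)] @ drop i S) else None)"
| "pass S (i, Cap) =
     (if i + 1 < length S \<and> fst (S ! i) = fst (S ! (i + 1)) \<and> snd (S ! i) \<noteq> snd (S ! (i + 1))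
      then Some (take i S @ drop (i + 2) S) else None)"
| "pass S (i, Cross c) =
     (if i + 1 < length S then Some (take i S @ [S ! (i + 1), S ! i] @ drop (i + 2) S) else None)"
| "pass S (i, Bar) = (if i < length S then Some S else None)"

fun run :: "'l strand list \<Rightarrow> 'l word \<Rightarrow> 'l strand list option" where
  "run S [] = Some S"
| "run S (e # w) = Option.bind (pass S e) (\<lambda>S'. run S' w)"

definition twisted_diagram :: "'l word \<Rightarrow> bool" where
  "twisted_diagram D \<longleftrightarrow> run [] D = Some []"

definition virtual_diagram :: "'l word \<Rightarrow> bool" where
  "virtual_diagram D \<longleftrightarrow> twisted_diagram D \<and> Bar \<notin> snd ` set D"


section \<open>Components\<close>

text \<open>
  \<open>(t, q)\<close> is the point on the \<open>q\<close>-th strand between the singular levels \<open>t - 1\<close> and \<open>t\<close>.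
  \<open>adjacent\<close> relates two such points if the curves run directly from one to the other through a
  single singular level.
\<close>

definition strands_at :: "'l word \<Rightarrow> nat \<Rightarrow> 'l strand list" where
  "strands_at D t = the (run [] (take t D))"

definition points :: "'l word \<Rightarrow> (nat \<times> nat) set" where
  "points D = {(t, q). t \<le> length D \<and> q < length (strands_at D t)}"

definition label_at :: "'l word \<Rightarrow> nat \<times> nat \<Rightarrow> 'l" where
  "label_at D P = fst (strands_at D (fst P) ! snd P)"

inductive adjacent :: "'l word \<Rightarrow> nat \<times> nat \<Rightarrow> nat \<times> nat \<Rightarrow> bool" for D where
  left: "t < length D \<Longrightarrow> D ! t = (i, p) \<Longrightarrow> q < i \<Longrightarrow> adjacent D (t, q) (t + 1, q)"
| right: "t < length D \<Longrightarrow> D ! t = (i, p) \<Longrightarrow> i \<le> q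
     \<Longrightarrow> adjacent D (t, q + ends_below p) (t + 1, q + ends_above p)"
| cup: "t < length D \<Longrightarrow> D ! t = (i, Cup x d) \<Longrightarrow> adjacent D (t + 1, i) (t + 1, i + 1)"
| cap: "t < length D \<Longrightarrow> D ! t = (i, Cap) \<Longrightarrow> adjacent D (t, i) (t, i + 1)"
| cross_SW: "t < length D \<Longrightarrow> D ! t = (i, Cross c) \<Longrightarrow> adjacent D (t, i) (t + 1, i + 1)"
| cross_SE: "t < length D \<Longrightarrow> D ! t = (i, Cross c) \<Longrightarrow> adjacent D (t, i + 1) (t + 1, i)"
| bar: "t < length D \<Longrightarrow> D ! t = (i, Bar) \<Longrightarrow> adjacent D (t, i) (t + 1, i)"

definition same_component :: "'l word \<Rightarrow> nat \<times> nat \<Rightarrow> nat \<times> nat \<Rightarrow> bool" where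
  "same_component D = equivclp (adjacent D)"

text \<open>
  Arbitrary labelled diagrams are partitioned diagrams.  In an ordered diagram the labels number
  the components: they are \<open>1, \<dots>, m\<close>, and each of them is carried by exactly one closed curve.
\<close>

definition ordered_twisted_diagram :: "nat word \<Rightarrow> bool" where
  "ordered_twisted_diagram D \<longleftrightarrow>
     twisted_diagram D \<and>
     (\<exists>m. label_at D ` points D = {1..m}) \<and>
     (\<forall>P\<in>points D. \<forall>Q\<in>points D. label_at D P = label_at D Q \<longrightarrow> same_component D P Q)"

definition forget_labels :: "'l word \<Rightarrow> unit word" where
  "forget_labels = map (map_prod id (map_piece (\<lambda>_. ())))"


section \<open>Moves\<close>

text \<open>
  The moves are given as pairs of lists of consecutive singular levels.  They are only applied
  where both sides fit (see \<open>local_change\<close>), which forces the labels and directions on the two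
  sides to agree; all orientations of the strands are thereby included.
\<close>

fun switch :: "crossing \<Rightarrow> crossing" where
  "switch Over = Under"
| "switch Under = Over"
| "switch Virtual = Virtual"

definition classical :: "crossing \<Rightarrow> bool" where
  "classical c \<longleftrightarrow> c \<noteq> Virtual"

text \<open>
  Isotopies of the plane: two singular levels at disjoint places exchange heights; a minimum and
  a maximum cancel; a crossing is moved over a maximum or a minimum of one of its strands
  (whereby the strand from SW to NE becomes the strand from SE to NW); a bar is moved over a
  maximum or a minimum.
\<close>

inductive isotopy_move :: "'l word \<Rightarrow> 'l word \<Rightarrow> bool" where
  exchange: "i \<le> j \<Longrightarrow> isotopy_move [(i, p), (j + ends_above p, q)] [(j + ends_below p, q), (i, p)]"
| cancel_right: "isotopy_move [(i + 1, Cup x d), (i, Cap)] []"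
| cancel_left: "isotopy_move [(i, Cup x d), (i + 1, Cap)] []"
| cross_cap: "isotopy_move [(i, Cross c), (i + 1, Cap)] [(i + 1, Cross (switch c)), (i, Cap)]"
| cross_cup: "isotopy_move [(i, Cup x d), (i + 1, Cross c)] [(i + 1, Cup x d), (i, Cross (switch c))]"
| bar_cap: "isotopy_move [(i, Bar), (i, Cap)] [(i + 1, Bar), (i, Cap)]"
| bar_cup: "isotopy_move [(i, Cup x d), (i, Bar)] [(i, Cup x d), (i + 1, Bar)]"

text \<open>
  In \<open>R3\<close>, the kinds \<open>a\<close>, \<open>b\<close>, \<open>c\<close> belong to the crossings of the first and second, the first and
  third, and the second and third strand.  The side condition says that the three strands are
  linearly ordered by running over each other.
\<close>

inductive generalized_move :: "'l word \<Rightarrow> 'l word \<Rightarrow> bool" where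
  R1_right: "classical c \<Longrightarrow> generalized_move [(i + 1, Cup x d), (i, Cross c), (i + 1, Cap)] []"
| R1_left: "classical c \<Longrightarrow> generalized_move [(i, Cup x d), (i + 1, Cross c), (i, Cap)] []"
| R2: "classical c \<Longrightarrow> generalized_move [(i, Cross c), (i, Cross (switch c))] []"
| R3: "classical a \<Longrightarrow> classical b \<Longrightarrow> classical c \<Longrightarrow> \<not> (a = c \<and> b \<noteq> a)
     \<Longrightarrow> generalized_move [(i, Cross a), (i + 1, Cross b), (i, Cross c)]
                          [(i + 1, Cross c), (i, Cross b), (i + 1, Cross a)]"
| V1_right: "generalized_move [(i + 1, Cup x d), (i, Cross Virtual), (i + 1, Cap)] []"
| V1_left: "generalized_move [(i, Cup x d), (i + 1, Cross Virtual), (i, Cap)] []"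
| V2: "generalized_move [(i, Cross Virtual), (i, Cross Virtual)] []"
| V3: "generalized_move [(i, Cross Virtual), (i + 1, Cross Virtual), (i, Cross Virtual)]
                        [(i + 1, Cross Virtual), (i, Cross Virtual), (i + 1, Cross Virtual)]"
| V4_first: "classical c \<Longrightarrow>
     generalized_move [(i, Cross Virtual), (i + 1, Cross Virtual), (i, Cross c)]
                      [(i + 1, Cross c), (i, Cross Virtual), (i + 1, Cross Virtual)]"
| V4_second: "classical c \<Longrightarrow>
     generalized_move [(i, Cross Virtual), (i + 1, Cross c), (i, Cross Virtual)]
                      [(i + 1, Cross Virtual), (i, Cross c), (i + 1, Cross Virtual)]"
| V4_third: "classical c \<Longrightarrow>
     generalized_move [(i, Cross c), (i + 1, Cross Virtual), (i, Cross Virtual)]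
                      [(i + 1, Cross Virtual), (i, Cross Virtual), (i + 1, Cross c)]"

text \<open>
  In \<open>T3\<close> the kind \<open>c\<close> is the same on both sides: on the right-hand side the strand that joins SW
  to NE in the whole tangle enters the classical crossing from SE, so it runs over there iff it
  runs under on the left-hand side.
\<close>

inductive bar_move :: "'l word \<Rightarrow> 'l word \<Rightarrow> bool" where
  T1_SW: "bar_move [(i, Bar), (i, Cross Virtual)] [(i, Cross Virtual), (i + 1, Bar)]"
| T1_SE: "bar_move [(i + 1, Bar), (i, Cross Virtual)] [(i, Cross Virtual), (i, Bar)]"
| T2: "bar_move [(i, Bar), (i, Bar)] []"
| T3: "classical c \<Longrightarrow>
     bar_move [(i, Bar), (i + 1, Bar), (i, Cross c), (i, Bar), (i + 1, Bar)]
              [(i, Cross Virtual), (i, Cross c), (i, Cross Virtual)]"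


section \<open>Equivalence\<close>

inductive local_change :: "('l word \<Rightarrow> 'l word \<Rightarrow> bool) \<Rightarrow> 'l word \<Rightarrow> 'l word \<Rightarrow> bool" for M where
  "M l r \<Longrightarrow> local_change M (u @ l @ v) (u @ r @ v)"

definition virtual_step :: "'l word \<Rightarrow> 'l word \<Rightarrow> bool" where
  "virtual_step D E \<longleftrightarrow> virtual_diagram D \<and> virtual_diagram E \<and>
     local_change (\<lambda>l r. isotopy_move l r \<or> generalized_move l r) D E"

definition twisted_step :: "'l word \<Rightarrow> 'l word \<Rightarrow> bool" where
  "twisted_step D E \<longleftrightarrow> twisted_diagram D \<and> twisted_diagram E \<and>
     local_change (\<lambda>l r. isotopy_move l r \<or> generalized_move l r \<or> bar_move l r) D E"

definition virtual_equivalent :: "'l word \<Rightarrow> 'l word \<Rightarrow> bool" where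
  "virtual_equivalent D E \<longleftrightarrow> virtual_diagram D \<and> virtual_diagram E \<and> equivclp virtual_step D E"

definition twisted_equivalent :: "'l word \<Rightarrow> 'l word \<Rightarrow> bool" where
  "twisted_equivalent D E \<longleftrightarrow> twisted_diagram D \<and> twisted_diagram E \<and> equivclp twisted_step D E"


section \<open>The double covering diagram\<close>

text \<open>
  If \<open>n\<close> strands of \<open>D\<close> pass through some height, then \<open>2 * n\<close> strands of the double covering
  diagram do: the strands of \<open>s(D)\<close> at the positions \<open>0, \<dots>, n - 1\<close>, in reversed order, followed by
  those of \<open>D\<close>.  A singular level of \<open>D\<close> other than a bar yields its mirror image followed by
  itself.  Reflection in the vertical axis preserves the heights, hence the directions of
  the strands, and exchanges the two strands at a crossing; switching over and under then
  restores the kind of the crossing.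
\<close>

fun mirror :: "'l piece \<Rightarrow> 'l piece" where
  "mirror (Cup x d) = Cup x (\<not> d)"
| "mirror Cap = Cap"
| "mirror (Cross c) = Cross c"
| "mirror Bar = Bar"

text \<open>
  For a bar on strand \<open>i\<close> the strands \<open>n - 1 - i\<close> and \<open>n + i\<close> are exchanged, crossing each other
  and the \<open>2 * i\<close> strands between them, by virtual crossings only.
\<close>

definition bar_cover :: "nat \<Rightarrow> nat \<Rightarrow> 'l word" where
  "bar_cover n i = (let j = n - 1 - i in
     map (\<lambda>k. (k, Cross Virtual)) ([j..<j + 2 * i + 1] @ rev [j..<j + 2 * i]))"

fun level_cover :: "nat \<Rightarrow> nat \<times> 'l piece \<Rightarrow> 'l word" where
  "level_cover n (i, Bar) = bar_cover n i"
| "level_cover n (i, p) =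
     [(n - i - ends_below p, mirror p), (n + ends_above p - ends_below p + i, p)]"

fun cover_from :: "nat \<Rightarrow> 'l word \<Rightarrow> 'l word" where
  "cover_from n [] = []"
| "cover_from n ((i, p) # w) =
     level_cover n (i, p) @ cover_from (n + ends_above p - ends_below p) w"

definition double_cover :: "'l word \<Rightarrow> 'l word" where
  "double_cover D = cover_from 0 D"

end

theory Submission
  imports Defs "HOL-Library.Z2"
begin

text \<open>
  Let \<open>K\<close> be two curls side by side, with bars at both ends of the curled strands, and let \<open>t\<close> be
  the virtual braid that interchanges the two other strands.  Closing \<open>t K\<close> and \<open>K t\<close> by two minima
  and two maxima gives two twisted knots.

  In the double coverings the mirror images of the two curls may be interchanged, as a block \<open>z\<close> of
  virtual crossings slides through them by detour moves.  Carried through the virtual crossings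
  that replace the bars, the two copies of \<open>z\<close> turn the cover of \<open>t\<close> below \<open>K\<close> into the cover of \<open>t\<close>
  above \<open>K\<close>, up to interchanges of two parallel minima and of two parallel maxima.

  The two twisted knots are told apart by colourings with values in the square of the field with
  two elements.  A curl can only be coloured if the second coordinates of its two incoming colours
  agree, which a bar just above the minimum prevents in the closure of \<open>K t\<close>; the closure
  of \<open>t K\<close> has colourings.  Adding \<open>n\<close> trivial circles yields the infinite family, distinguished by
  the number of components.
\<close>


section \<open>Tangles up to virtual moves\<close>

text \<open>A virtual braid in a twisted diagram lifts to the same interchange in both halves of the
  covering. The block \<open>z\<close> acts on the mirror half only, so its slide is not the lift of
  a slide of such a braid in the twisted diagram. \<open>z\<close> exchanges the mirror images of
  strands 0 and 2 and those of strands 1 and 3. The bars sit on strands 0 and 2, so conjugation by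
  their crossings keeps the second exchange and turns the first into the exchange of strands 0 and 2
  of the diagram itself. Multiplying by the block interchange of that half cancels this exchange and
  leaves strands 1 and 3 exchanged in both halves: the cover of \<open>t\<close>. This is why the
  bars lie on the curled strands and \<open>t\<close> moves the other two. The formal obstacle is
  that a word is a diagram only if each level fits the strands below it, and every stage of an
  equivalence has to be one. Equivalence is therefore studied relative to a list of incoming
  strands. Virtual braids are compared through their permutations, which reduces the relations
  between \<open>t\<close>, \<open>z\<close> and the bars to evaluation.\<close>

lemma run_append: "run S (u @ v) = Option.bind (run S u) (\<lambda>T. run T v)"
  by (induction u arbitrary: S) (auto split: bind_split)

text \<open>A level reads and changes only the strands at its own place. The exchange of distant
  levels and the shifting of whole tangles rest on this.\<close>

lemma pass_local:
  assumes "length L = ends_below p"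
  shows "pass (A @ L @ B) (length A, p) = map_option (\<lambda>L'. A @ L' @ B) (pass L (0, p))"
  using assms
  by (cases p) (auto simp: nth_append length_Suc_conv numeral_2_eq_2)

lemma pass_length:
  assumes "pass S (i, p) = Some T"
  shows "i + ends_below p \<le> length S" "length T + ends_below p = length S + ends_above p"
  using assms by (cases p; auto split: if_splits)+

lemma pass_split:
  assumes "pass S (i, p) = Some T"
  obtains A L L' B where "S = A @ L @ B" "length A = i" "length L = ends_below p"
    "pass L (0, p) = Some L'" "length L' = ends_above p" "T = A @ L' @ B"
proof -
  define A L B where "A = take i S" and "L = take (ends_below p) (drop i S)"
    and "B = drop (i + ends_below p) S"
  have S: "S = A @ L @ B"
    by (metis A_def B_def L_def add.commute append_take_drop_id drop_drop)
  have A: "length A = i" and L: "length L = ends_below p"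
    using pass_length(1)[OF assms] by (auto simp: A_def L_def)
  obtain L' where L': "pass L (0, p) = Some L'" "T = A @ L' @ B"
    using assms pass_local[OF L, of A B] unfolding S[symmetric] A by auto
  moreover have "length L' = ends_above p" using pass_length(2)[OF L'(1)] L by simp
  ultimately show thesis using that S A L by blast
qed

lemma split_two_blocks:
  assumes "i + m \<le> k" "k + n \<le> length xs"
  obtains A L B M C where "xs = A @ L @ B @ M @ C" "length A = i" "length L = m"
    "length B = k - (i + m)" "length M = n"
proof -
  have split: "drop a xs = take b (drop a xs) @ drop (a + b) xs" for a b
    by (metis add.commute append_take_drop_id drop_drop)
  have "xs = take i xs @ take m (drop i xs) @ take (k - (i + m)) (drop (i + m) xs)
      @ take n (drop k xs) @ drop (k + n) xs"
    using split[of 0 i] split[of i m] split[of "i + m" "k - (i + m)"] split[of k n] assms(1) by simp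
  then show thesis by (rule that) (use assms in auto)
qed

lemma run_exchange:
  assumes "i \<le> j"
  shows "run S [(i, p), (j + ends_above p, q)] = run S [(j + ends_below p, q), (i, p)]"
proof (cases "j + ends_below p + ends_below q \<le> length S")
  case True
  have "i + ends_below p \<le> j + ends_below p" using assms by simp
  then obtain A L B M C where S: "S = A @ L @ B @ M @ C" and
    "length A = i" "length L = ends_below p" "length B = j + ends_below p - (i + ends_below p)"
    "length M = ends_below q"
    using True by (rule split_two_blocks)
  then have l: "length A = i" "length L = ends_below p" "length B = j - i" "length M = ends_below q"
    by simp_all
  have 1: "pass S (i, p) = map_option (\<lambda>L'. A @ L' @ B @ M @ C) (pass L (0, p))"
    using pass_local[OF l(2), of A "B @ M @ C"] S l by simp
  have 2: "pass S (j + ends_below p, q) = map_option (\<lambda>M'. A @ L @ B @ M' @ C) (pass M (0, q))"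
    using pass_local[OF l(4), of "A @ L @ B" C] S l assms by (simp add: add.commute)
  show ?thesis
  proof (cases "pass L (0, p)")
    case None
    have "pass (A @ L @ B @ M' @ C) (i, p) = None" for M'
      using pass_local[OF l(2), of A "B @ M' @ C"] l None by simp
    then show ?thesis using 1 2 None by (cases "pass M (0, q)") auto
  next
    case (Some L')
    have "length L' = ends_above p" using pass_length(2)[OF Some] l by simp
    then have 3: "pass (A @ L' @ B @ M @ C) (j + ends_above p, q) = map_option (\<lambda>M'. A @ L' @ B @ M' @ C) (pass M (0, q))"
      using pass_local[OF l(4), of "A @ L' @ B" C] l assms by (simp add: add.commute)
    have 4: "pass (A @ L @ B @ M' @ C) (i, p) = Some (A @ L' @ B @ M' @ C)" for M'
      using pass_local[OF l(2), of A "B @ M' @ C"] l Some by simp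
    show ?thesis using 1 2 3 4 Some by (cases "pass M (0, q)") auto
  qed
next
  case False
  \<comment> \<open>With too few strands both orders fail: \<open>q\<close>, the level further to
    the right, runs off the end of the list whether it comes before or after
    \<open>p\<close>.\<close>
  have 1: "pass S (j + ends_below p, q) = None"
    using pass_length(1)[of S "j + ends_below p" q] False by (cases "pass S (j + ends_below p, q)") auto
  show ?thesis
  proof (cases "pass S (i, p)")
    case (Some T)
    have "pass T (j + ends_above p, q) = None"
      using pass_length(1)[of T "j + ends_above p" q] pass_length(2)[OF Some] False
      by (cases "pass T (j + ends_above p, q)") auto
    then show ?thesis using 1 Some by simp
  qed (use 1 in simp)
qed

section \<open>Equivalence of tangles with given incoming strands\<close>

abbreviation virtual_move :: "'l word \<Rightarrow> 'l word \<Rightarrow> bool" where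
  "virtual_move l r \<equiv> isotopy_move l r \<or> generalized_move l r"

definition tangle_step :: "'l strand list \<Rightarrow> 'l word \<Rightarrow> 'l word \<Rightarrow> bool" where
  "tangle_step S v w \<longleftrightarrow> run S v = run S w \<and> local_change virtual_move v w"

text \<open>Two words that both fail to fit count as equivalent, so the congruence rules need no
  fitting conditions. \<open>tangle_step\<close> asks only for equal runs: the run is constant along
  a chain, so one fitting word makes every word of the chain fit.\<close>

definition tangle_eq :: "'l strand list \<Rightarrow> 'l word \<Rightarrow> 'l word \<Rightarrow> bool" where
  "tangle_eq S v w \<longleftrightarrow> run S v = run S w \<and> (run S v \<noteq> None \<longrightarrow> equivclp (tangle_step S) v w)"

lemma tangle_eq_None: "run S u = None \<Longrightarrow> run S v = None \<Longrightarrow> tangle_eq S u v"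
  by (simp add: tangle_eq_def)

lemma tangle_eq_refl [simp, intro!]: "tangle_eq S w w"
  by (simp add: tangle_eq_def)

lemma tangle_eq_sym: "tangle_eq S v w \<Longrightarrow> tangle_eq S w v"
  by (auto simp: tangle_eq_def intro: equivclp_sym)

lemma tangle_eq_trans [trans]: "tangle_eq S u v \<Longrightarrow> tangle_eq S v w \<Longrightarrow> tangle_eq S u w"
  by (auto simp: tangle_eq_def intro: equivclp_trans)

lemma tangle_eq_run: "tangle_eq S v w \<Longrightarrow> run S v = run S w"
  by (simp add: tangle_eq_def)

lemma local_change_context: "local_change M v w \<Longrightarrow> local_change M (a @ v @ b) (a @ w @ b)"
proof (induction rule: local_change.induct)
  case (1 l r u v)
  from local_change.intros[of M, OF this, of "a @ u" "v @ b"] show ?case by simp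
qed

text \<open>Only the strands that arrive above \<open>a\<close> matter for the inner equivalence; if
  \<open>a\<close> does not fit, both composites fail.\<close>

lemma tangle_eq_context:
  assumes "\<And>T. run S a = Some T \<Longrightarrow> tangle_eq T v w"
  shows "tangle_eq S (a @ v @ b) (a @ w @ b)"
proof (cases "run S a")
  case None
  then show ?thesis by (simp add: tangle_eq_def run_append)
next
  case (Some T)
  have "tangle_eq T v w" by (rule assms[OF Some])
  then have run: "run T v = run T w" and eq: "run T v \<noteq> None \<Longrightarrow> equivclp (tangle_step T) v w"
    by (auto simp: tangle_eq_def)
  show ?thesis
  proof (cases "run T v = None")
    case True
    then show ?thesis using Some run by (simp add: tangle_eq_def run_append)
  next
    case False
    have "equivclp (tangle_step S) (a @ v @ b) (a @ w @ b)"
      using eq[OF False]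
    proof (induction rule: equivclp_induct)
      case (step y z)
      have "tangle_step S (a @ y @ b) (a @ z @ b) \<or> tangle_step S (a @ z @ b) (a @ y @ b)"
        using step(2) Some by (auto simp: tangle_step_def run_append intro: local_change_context)
      then show ?case using step(3)
        by (meson equivclp_sym equivclp_trans r_into_equivclp)
    qed simp
    then show ?thesis using Some run by (simp add: tangle_eq_def run_append)
  qed
qed

lemma tangle_eq_append:
  assumes "tangle_eq S u u'" "\<And>T. run S u = Some T \<Longrightarrow> tangle_eq T v v'"
  shows "tangle_eq S (u @ v) (u' @ v')"
proof -
  have "tangle_eq S (u @ v) (u' @ v)"
    using tangle_eq_context[of S "[]" u u' v] assms(1) by simp
  also have "tangle_eq S (u' @ v) (u' @ v')"
    using tangle_eq_context[of S u' v v' "[]"] assms by (simp add: tangle_eq_run)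
  finally show ?thesis .
qed

lemma tangle_eq_append_left: "tangle_eq S u u' \<Longrightarrow> tangle_eq S (u @ v) (u' @ v)"
  by (intro tangle_eq_append) auto

lemma tangle_eq_append_right: "(\<And>T. tangle_eq T v v') \<Longrightarrow> tangle_eq S (u @ v) (u @ v')"
  by (intro tangle_eq_append) auto

lemma tangle_eq_context_run:
  "run S a = Some T \<Longrightarrow> tangle_eq T v w \<Longrightarrow> tangle_eq S (a @ v @ b) (a @ w @ b)"
  by (rule tangle_eq_context) simp

lemma tangle_eq_append_run: "run S a = Some T \<Longrightarrow> tangle_eq T v w \<Longrightarrow> tangle_eq S (a @ v) (a @ w)"
  using tangle_eq_context_run[of S a T v w "[]"] by simp

lemma tangle_eq_Cons:
  assumes "\<And>T. pass S e = Some T \<Longrightarrow> tangle_eq T v w"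
  shows "tangle_eq S (e # v) (e # w)"
  using tangle_eq_append[of S "[e]" "[e]" v w] assms by simp

lemma tangle_eq_move:
  assumes "virtual_move l r" "run S l = run S r"
  shows "tangle_eq S l r"
proof -
  have "local_change virtual_move ([] @ l @ []) ([] @ r @ [])"
    using assms(1) by (rule local_change.intros)
  then show ?thesis using assms(2) by (auto simp: tangle_eq_def tangle_step_def)
qed

lemma tangle_eq_exchange:
  "i \<le> j \<Longrightarrow> tangle_eq S [(i, p), (j + ends_above p, q)] [(j + ends_below p, q), (i, p)]"
  by (intro tangle_eq_move run_exchange disjI1 isotopy_move.exchange)

text \<open>\<open>virtual_equivalent\<close> demands a virtual diagram at every stage. Since no
  such move creates the first bar or removes the last, a chain that starts without bars stays
  without bars.\<close>

lemma virtual_move_Bar: "virtual_move l r \<Longrightarrow> Bar \<in> snd ` set l \<longleftrightarrow> Bar \<in> snd ` set r"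
  by (auto elim!: isotopy_move.cases generalized_move.cases)

lemma local_change_Bar:
  "local_change virtual_move v w \<Longrightarrow> Bar \<in> snd ` set v \<longleftrightarrow> Bar \<in> snd ` set w"
proof (induction rule: local_change.induct)
  case (1 l r u v)
  from virtual_move_Bar[OF this] show ?case by (simp add: image_Un)
qed

lemma virtual_equivalentI:
  assumes "tangle_eq [] D E" "virtual_diagram D"
  shows "virtual_equivalent D E"
proof -
  have D: "run [] D = Some []" "Bar \<notin> snd ` set D"
    using assms(2) by (auto simp: virtual_diagram_def twisted_diagram_def)
  then have "equivclp (tangle_step []) D E"
    using assms(1) by (simp add: tangle_eq_def)
  then have "virtual_diagram E \<and> equivclp virtual_step D E"
  proof (induction rule: equivclp_induct)
    case base
    then show ?case using assms(2) by simp
  next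
    case (step y z)
    have run: "run [] y = run [] z" and lc: "local_change virtual_move y z \<or> local_change virtual_move z y"
      using step(2) by (auto simp: tangle_step_def)
    from lc have "Bar \<in> snd ` set y \<longleftrightarrow> Bar \<in> snd ` set z"
      using local_change_Bar by blast
    then have z: "virtual_diagram z" using run step(3) by (auto simp: virtual_diagram_def twisted_diagram_def)
    then have "virtual_step y z \<or> virtual_step z y" using lc step(3) by (auto simp: virtual_step_def)
    then show ?case using step(3) z by (meson equivclp_sym equivclp_trans r_into_equivclp)
  qed
  then show ?thesis using assms(2) by (simp add: virtual_equivalent_def)
qed


section \<open>Virtual braids\<close>

definition swap_word :: "nat list \<Rightarrow> 'l word" where
  "swap_word ks = map (\<lambda>k. (k, Cross Virtual)) ks"

lemma swap_word_simps [simp]: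
  "swap_word [] = []" "swap_word (k # ks) = (k, Cross Virtual) # swap_word ks"
  "swap_word (ks @ ls) = swap_word ks @ swap_word ls"
  by (simp_all add: swap_word_def)

fun swap_at :: "nat \<Rightarrow> 'a list \<Rightarrow> 'a list" where
  "swap_at k xs = take k xs @ [xs ! (k + 1), xs ! k] @ drop (k + 2) xs"

declare swap_at.simps [simp del]

text \<open>The action is on places, so the same word acts on lists of strands and on the test list
  \<open>[0..<n]\<close>, where its permutation can be computed.\<close>

definition permute :: "nat list \<Rightarrow> 'a list \<Rightarrow> 'a list" where
  "permute ks xs = fold swap_at ks xs"

lemma permute_simps [simp]:
  "permute [] xs = xs" "permute (k # ks) xs = permute ks (swap_at k xs)"
  "permute (ks @ ls) xs = permute ls (permute ks xs)"
  by (simp_all add: permute_def)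

lemma swap_at_local [simp]: "swap_at (length A) (A @ x # y # B) = A @ y # x # B"
  by (simp add: swap_at.simps nth_append)

lemma length_swap_at [simp]: "k + 1 < length xs \<Longrightarrow> length (swap_at k xs) = length xs"
  by (simp add: swap_at.simps)

lemma swap_at_append [simp]: "k + 1 < length xs \<Longrightarrow> swap_at k (xs @ ys) = swap_at k xs @ ys"
  by (simp add: swap_at.simps nth_append)

lemma split_at_pair:
  assumes "k + 1 < length xs"
  obtains A x y B where "xs = A @ x # y # B" "k = length A"
proof
  show "xs = take k xs @ xs ! k # xs ! (k + 1) # drop (k + 2) xs"
    using assms by (simp add: Cons_nth_drop_Suc)
qed (use assms in simp)

lemma set_swap_at [simp]: "k + 1 < length xs \<Longrightarrow> set (swap_at k xs) = set xs"
  by (erule split_at_pair) auto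

lemma distinct_swap_at [simp]: "k + 1 < length xs \<Longrightarrow> distinct (swap_at k xs) = distinct xs"
  by (erule split_at_pair) auto

definition fitting :: "nat \<Rightarrow> nat list \<Rightarrow> bool" where
  "fitting n ks \<longleftrightarrow> (\<forall>k\<in>set ks. k + 1 < n)"

lemma fitting_simps [simp]:
  "fitting n []" "fitting n (k # ks) \<longleftrightarrow> k + 1 < n \<and> fitting n ks"
  "fitting n (ks @ ls) \<longleftrightarrow> fitting n ks \<and> fitting n ls"
  by (auto simp: fitting_def)

lemma permute_props:
  "fitting (length xs) ks \<Longrightarrow> length (permute ks xs) = length xs"
  "fitting (length xs) ks \<Longrightarrow> set (permute ks xs) = set xs"
  "fitting (length xs) ks \<Longrightarrow> distinct (permute ks xs) = distinct xs"
  "fitting (length xs) ks \<Longrightarrow> permute ks (xs @ ys) = permute ks xs @ ys"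
  by (induction ks arbitrary: xs) auto

lemma run_swap_word: "fitting (length S) ks \<Longrightarrow> run S (swap_word ks) = Some (permute ks S)"
proof (induction ks arbitrary: S)
  case (Cons k ks)
  then have "pass S (k, Cross Virtual) = Some (swap_at k S)" by (simp add: swap_at.simps)
  then show ?case using Cons by (simp del: pass.simps)
qed simp

section \<open>The Coxeter presentation of the symmetric group\<close>

inductive coxeter_step :: "nat \<Rightarrow> nat list \<Rightarrow> nat list \<Rightarrow> bool" for n where
  far: "k + 2 \<le> l \<Longrightarrow> fitting n (u @ [k, l] @ v) \<Longrightarrow> coxeter_step n (u @ [k, l] @ v) (u @ [l, k] @ v)"
| braid: "fitting n (u @ [k, k + 1, k] @ v) \<Longrightarrow>
    coxeter_step n (u @ [k, k + 1, k] @ v) (u @ [k + 1, k, k + 1] @ v)"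
| cancel: "fitting n (u @ [k, k] @ v) \<Longrightarrow> coxeter_step n (u @ [k, k] @ v) (u @ v)"

abbreviation coxeter_eq :: "nat \<Rightarrow> nat list \<Rightarrow> nat list \<Rightarrow> bool" where
  "coxeter_eq n \<equiv> equivclp (coxeter_step n)"

lemma coxeter_step_context:
  assumes "coxeter_step n a b" "n \<le> m" "fitting m u" "fitting m v"
  shows "coxeter_step m (u @ a @ v) (u @ b @ v)"
  using assms(1)
proof cases
  case (far k l u' v')
  have "coxeter_step m ((u @ u') @ [k, l] @ (v' @ v)) ((u @ u') @ [l, k] @ (v' @ v))"
    using far assms by (intro coxeter_step.far) (auto simp: fitting_def intro: less_le_trans)
  then show ?thesis using far by simp
next
  case (braid u' k v')
  have "coxeter_step m ((u @ u') @ [k, k + 1, k] @ (v' @ v)) ((u @ u') @ [k + 1, k, k + 1] @ (v' @ v))"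
    using braid assms by (intro coxeter_step.braid) (auto simp: fitting_def intro: less_le_trans)
  then show ?thesis using braid by simp
next
  case (cancel u' k v')
  have "coxeter_step m ((u @ u') @ [k, k] @ (v' @ v)) ((u @ u') @ (v' @ v))"
    using cancel assms by (intro coxeter_step.cancel) (auto simp: fitting_def intro: less_le_trans)
  then show ?thesis using cancel by simp
qed

lemma coxeter_eq_context:
  assumes "coxeter_eq n a b" "n \<le> m" "fitting m u" "fitting m v"
  shows "coxeter_eq m (u @ a @ v) (u @ b @ v)"
  using assms(1)
proof (induction rule: equivclp_induct)
  case (step y z)
  then have "coxeter_eq m (u @ y @ v) (u @ z @ v)"
    using coxeter_step_context[OF _ assms(2-4)] by (meson equivclp_sym r_into_equivclp)
  then show ?case using step(3) equivclp_trans by metis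
qed simp

lemma coxeter_eq_trans [trans]: "coxeter_eq n a b \<Longrightarrow> coxeter_eq n b c \<Longrightarrow> coxeter_eq n a c"
  by (rule equivclp_trans)

lemma coxeter_eq_commute:
  assumes "\<forall>l\<in>set ls. k + 2 \<le> l \<or> l + 2 \<le> k" "k + 1 < n" "fitting n ls"
  shows "coxeter_eq n (ls @ [k]) (k # ls)"
  using assms
proof (induction ls)
  case (Cons l ls)
  have "coxeter_eq n ([l] @ (ls @ [k]) @ []) ([l] @ (k # ls) @ [])"
    using Cons by (intro coxeter_eq_context[where n = n]) auto
  also have "coxeter_eq n ([l] @ (k # ls) @ []) (k # l # ls)"
  proof (cases "k + 2 \<le> l")
    case True
    then show ?thesis
      using r_into_equivclp[of "coxeter_step n", OF coxeter_step.far[of k l n "[]" ls]] Cons.prems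
      by (auto intro: equivclp_sym)
  next
    case False
    then show ?thesis
      using coxeter_step.far[of l k n "[]" ls] Cons.prems
      by (auto intro!: r_into_equivclp)
  qed
  finally show ?case by simp
qed simp

lemma rev_upt_split:
  assumes "j \<le> k" "k < n"
  shows "rev [j..<n] = rev [Suc k..<n] @ k # rev [j..<k]"
proof -
  have "[j..<n] = [j..<k] @ [k..<n]"
    using upt_add_eq_append[of j k "n - k"] assms by simp
  then show ?thesis using assms by (simp add: upt_conv_Cons)
qed

text \<open>Normal form: the last strand moves to its final place after the others have been permuted.\<close>

lemma coxeter_normal_form:
  assumes "fitting (Suc n) ks"
  shows "\<exists>ls j. j \<le> n \<and> fitting n ls \<and> coxeter_eq (Suc n) ks (ls @ rev [j..<n])"
  using assms
proof (induction ks rule: rev_induct)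
  case Nil
  have "coxeter_eq (Suc n) [] ([] @ rev [n..<n])" by simp
  then show ?case by (intro exI[of _ "[]"] exI[of _ n]) simp
next
  case (snoc k ks)
  then obtain ls j where j: "j \<le> n" "fitting n ls" and eq: "coxeter_eq (Suc n) ks (ls @ rev [j..<n])"
    by auto
  have k: "k < n" using snoc.prems by simp
  have down: "fitting (Suc n) (rev [i..<m])" if "m \<le> n" for i m
    using that by (auto simp: fitting_def)
  have ls: "fitting (Suc n) ls" using j by (auto simp: fitting_def)
  have "coxeter_eq (Suc n) ([] @ ks @ [k]) ([] @ (ls @ rev [j..<n]) @ [k])"
    using eq snoc.prems by (intro coxeter_eq_context[where n = "Suc n"]) auto
  then have eq: "coxeter_eq (Suc n) (ks @ [k]) (ls @ rev [j..<n] @ [k])" by simp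
  \<comment> \<open>The run \<open>rev [j..<n]\<close> descends from \<open>n - 1\<close> to
    \<open>j\<close>. A letter \<open>k\<close> below \<open>j - 1\<close> commutes into
    \<open>ls\<close>, the letter \<open>j - 1\<close> lengthens the run, \<open>j\<close> cancels
    its last letter, and a larger \<open>k\<close> re-emerges on the left as
    \<open>k - 1\<close>.\<close>
  consider "Suc k < j" | "Suc k = j" | "k = j" | "j < k" by linarith
  then show ?case
  proof cases
    case 1
    have "coxeter_eq (Suc n) (rev [j..<n] @ [k]) (k # rev [j..<n])"
      using 1 k by (intro coxeter_eq_commute down) auto
    then have "coxeter_eq (Suc n) (ls @ (rev [j..<n] @ [k]) @ []) (ls @ (k # rev [j..<n]) @ [])"
      using ls by (intro coxeter_eq_context[where n = "Suc n"]) auto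
    with eq have "coxeter_eq (Suc n) (ks @ [k]) ((ls @ [k]) @ rev [j..<n])"
      using equivclp_trans by force
    moreover have "fitting n (ls @ [k])" using 1 j by simp
    ultimately show ?thesis using j by blast
  next
    case 2
    then have "rev [j..<n] @ [k] = rev [k..<n]" using k by (simp add: upt_conv_Cons)
    then show ?thesis using eq j k by (intro exI[of _ ls] exI[of _ k]) simp
  next
    case 3
    then have "rev [j..<n] @ [k] = rev [Suc j..<n] @ [k, k]" using k by (simp add: upt_conv_Cons)
    moreover have "coxeter_step (Suc n) ((ls @ rev [Suc j..<n]) @ [k, k] @ []) ((ls @ rev [Suc j..<n]) @ [])"
      using ls k down[of n "Suc j"] by (intro coxeter_step.cancel) auto
    ultimately have "coxeter_eq (Suc n) (ks @ [k]) (ls @ rev [Suc j..<n])"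
      using eq equivclp_trans by fastforce
    then show ?thesis using j k 3 by (intro exI[of _ ls] exI[of _ "Suc j"]) simp
  next
    case 4
    \<comment> \<open>The run contains \<open>k, h\<close> in succession. The new \<open>k\<close>
      passes the letters below \<open>h\<close>, the braid relation turns \<open>k, h, k\<close>
      into \<open>h, k, h\<close>, and the first \<open>h\<close> passes the letters above
      \<open>k\<close> to join \<open>ls\<close>.\<close>
    define h where "h = k - 1"
    have h: "k = Suc h" "j \<le> h" using 4 by (auto simp: h_def)
    have split: "rev [j..<n] = rev [Suc k..<n] @ [k, h] @ rev [j..<h]"
      using rev_upt_split[of j k n] rev_upt_split[of j h k] 4 k h by simp
    have "coxeter_eq (Suc n) (rev [j..<h] @ [k]) (k # rev [j..<h])"
      using h k by (intro coxeter_eq_commute down) auto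
    then have "coxeter_eq (Suc n) ((ls @ rev [Suc k..<n] @ [k, h]) @ (rev [j..<h] @ [k]) @ [])
        ((ls @ rev [Suc k..<n] @ [k, h]) @ (k # rev [j..<h]) @ [])"
      using ls h k down[of n "Suc k"] by (intro coxeter_eq_context[where n = "Suc n"]) auto
    also have "\<dots> = (ls @ rev [Suc k..<n]) @ [h + 1, h, h + 1] @ rev [j..<h]" by (simp add: h)
    also have "coxeter_eq (Suc n) \<dots> ((ls @ rev [Suc k..<n]) @ [h, h + 1, h] @ rev [j..<h])"
      using ls h k down[of n "Suc k"] down[of h j]
      by (intro equivclp_sym[OF r_into_equivclp] coxeter_step.braid) auto
    also have "\<dots> = ls @ (rev [Suc k..<n] @ [h]) @ ([k, h] @ rev [j..<h])" by (simp add: h)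
    also have "coxeter_eq (Suc n) \<dots> (ls @ (h # rev [Suc k..<n]) @ ([k, h] @ rev [j..<h]))"
    proof (rule coxeter_eq_context[where n = "Suc n"])
      show "coxeter_eq (Suc n) (rev [Suc k..<n] @ [h]) (h # rev [Suc k..<n])"
        using h k by (intro coxeter_eq_commute down) auto
    qed (use ls h k down[of h j] in auto)
    also have "\<dots> = (ls @ [h]) @ rev [j..<n]" by (simp add: split)
    finally have "coxeter_eq (Suc n) (ls @ rev [j..<n] @ [k]) ((ls @ [h]) @ rev [j..<n])"
      by (simp add: split)
    with eq have "coxeter_eq (Suc n) (ks @ [k]) ((ls @ [h]) @ rev [j..<n])"
      by (rule equivclp_trans)
    moreover have "fitting n (ls @ [h])" using j h k by simp
    ultimately show ?thesis using j by blast
  qed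
qed

lemma coxeter_step_permute:
  assumes "coxeter_step (length xs) a b"
  shows "permute a xs = permute b xs"
proof -
  have *: "swap_at k (swap_at k ys) = ys" if "k + 1 < length ys" for k and ys :: "'a list"
    using split_at_pair[OF that] by (metis swap_at_local)
  have **: "swap_at l (swap_at k ys) = swap_at k (swap_at l ys)"
    if "k + 2 \<le> l" "l + 1 < length ys" for k l and ys :: "'a list"
  proof -
    have "k + 1 < length ys" using that by simp
    then obtain A x y B where 1: "ys = A @ x # y # B" "k = length A"
      by (rule split_at_pair)
    have "l - (k + 2) + 1 < length B" using that 1 by simp
    then obtain C u v D where 2: "B = C @ u # v # D" "l - (k + 2) = length C"
      by (rule split_at_pair)
    have l: "l = length (A @ x # y # C)" "l = length (A @ y # x # C)" using 1 2 that by auto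
    have "swap_at l (A @ x # y # C @ u # v # D) = A @ x # y # C @ v # u # D"
      using swap_at_local[of "A @ x # y # C" u v D] by (simp only: l(1) append_assoc append_Cons)
    moreover have "swap_at l (A @ y # x # C @ u # v # D) = A @ y # x # C @ v # u # D"
      using swap_at_local[of "A @ y # x # C" u v D] by (simp only: l(2) append_assoc append_Cons)
    ultimately show ?thesis unfolding 1 2(1) by simp
  qed
  have ***: "permute [k, k + 1, k] ys = permute [k + 1, k, k + 1] ys"
    if len: "k + 2 < length ys" for k and ys :: "'a list"
  proof -
    have "k + 1 < length ys" using len by simp
    then obtain A x y B where 1: "ys = A @ x # y # B" "k = length A"
      by (rule split_at_pair)
    then obtain z C where "B = z # C" using len by (cases B) auto
    then show ?thesis using 1 swap_at_local[of "A @ [_]"] by simp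
  qed
  show ?thesis using assms
    by cases (use * ** *** in \<open>simp_all add: permute_props\<close>)
qed

lemma coxeter_eq_permute: "coxeter_eq (length xs) a b \<Longrightarrow> permute a xs = permute b xs"
  by (induction rule: equivclp_induct) (auto dest: coxeter_step_permute)

lemma permute_down:
  assumes "length ys = n" "j \<le> n"
  shows "permute (rev [j..<n]) (ys @ [y]) = take j ys @ [y] @ drop j ys"
  using assms(2)
proof (induction rule: inc_induct)
  case (step m)
  then have "rev [m..<n] = rev [Suc m..<n] @ [m]" by (simp add: upt_conv_Cons)
  then have "permute (rev [m..<n]) (ys @ [y]) = swap_at m (take (Suc m) ys @ [y] @ drop (Suc m) ys)"
    using step by simp
  also have "\<dots> = take m ys @ [y] @ ys ! m # drop (Suc m) ys"
    using step assms(1) by (simp add: swap_at.simps nth_append take_Suc_conv_app_nth min_def)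
  finally show ?case using step assms(1) by (simp add: Cons_nth_drop_Suc)
qed (simp add: assms)

text \<open>Compare normal forms: the final place of the last entry determines the descending run,
  and the order of the other entries determines the permutation of the remaining word, to which
  induction applies. Distinctness of \<open>xs\<close> lets the permuted list remember the
  permutation.\<close>

lemma coxeter_eq_complete:
  assumes "fitting n a" "fitting n b" "length xs = n" "distinct xs" "permute a xs = permute b xs"
  shows "coxeter_eq n a b"
  using assms
proof (induction n arbitrary: a b xs)
  case 0
  then have "a = []" "b = []" by (cases a; cases b; simp)+
  then show ?case by simp
next
  case (Suc n)
  obtain a' i where a': "i \<le> n" "fitting n a'" "coxeter_eq (Suc n) a (a' @ rev [i..<n])"
    using coxeter_normal_form[OF Suc.prems(1)] by blast
  obtain b' j where b': "j \<le> n" "fitting n b'" "coxeter_eq (Suc n) b (b' @ rev [j..<n])"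
    using coxeter_normal_form[OF Suc.prems(2)] by blast
  obtain ys y where xs: "xs = ys @ [y]" "length ys = n"
    using Suc.prems(3) by (auto simp: length_Suc_conv_rev)
  define u v where "u = permute a' ys" and "v = permute b' ys"
  have len: "length u = n" "length v = n" and set: "set u = set ys" "set v = set ys"
    using permute_props(1,2)[of ys] xs a' b' by (auto simp: u_def v_def)
  have "permute a xs = take i u @ [y] @ drop i u"
    using coxeter_eq_permute[of xs a] a' Suc.prems(3) xs permute_down[OF len(1), of i y]
    by (simp add: permute_props u_def)
  moreover have "permute b xs = take j v @ [y] @ drop j v"
    using coxeter_eq_permute[of xs b] b' Suc.prems(3) xs permute_down[OF len(2), of j y]
    by (simp add: permute_props v_def)
  ultimately have eq: "take i u @ [y] @ drop i u = take j v @ [y] @ drop j v"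
    using Suc.prems(5) by simp
  have y: "y \<notin> set u" "y \<notin> set v" using set Suc.prems(4) xs by auto
  \<comment> \<open>As \<open>y\<close> does not occur among the other entries, it cuts both sides
    of \<open>eq\<close> at the same place.\<close>
  have split: "takeWhile (\<lambda>z. z \<noteq> y) (ps @ [y] @ qs) = ps" "dropWhile (\<lambda>z. z \<noteq> y) (ps @ [y] @ qs) = [y] @ qs"
    if "y \<notin> set ps" for ps qs
    using that by (simp_all add: takeWhile_append dropWhile_append)
  have "y \<notin> set (take i u)" "y \<notin> set (take j v)" using y by (auto dest: in_set_takeD)
  from split[OF this(1), of "drop i u"] split[OF this(2), of "drop j v"]
  have uv: "take i u = take j v" "drop i u = drop j v" using eq by simp_all
  have "length (take i u) = length (take j v)" using uv by simp
  then have "i = j" using len a'(1) b'(1) by simp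
  moreover have "take i u @ drop i u = take j v @ drop j v" using uv by simp
  ultimately have "u = v" "i = j" by simp_all
  then have "coxeter_eq n a' b'"
    using Suc.IH[of a' b' ys] a' b' xs Suc.prems(4) by (simp add: u_def v_def)
  then have "coxeter_eq (Suc n) ([] @ a' @ rev [i..<n]) ([] @ b' @ rev [i..<n])"
    using a' by (intro coxeter_eq_context) (auto simp: fitting_def)
  then have "coxeter_eq (Suc n) (a' @ rev [i..<n]) (b' @ rev [j..<n])"
    using \<open>i = j\<close> by simp
  then show ?case
    by (rule equivclp_trans[OF a'(3) equivclp_trans[OF _ equivclp_sym[OF b'(3)]]])
qed

text \<open>Commutation of distant letters is an exchange of heights, the braid relation is
  \<open>V3\<close> and cancellation is \<open>V2\<close>.\<close>

lemma coxeter_step_tangle_eq: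
  assumes "coxeter_step (length S) a b"
  shows "tangle_eq S (swap_word a) (swap_word b)"
  using assms
proof cases
  case (far k l u v)
  obtain m where l: "l = m + 2" "k \<le> m" using far by (auto simp: le_iff_add ac_simps)
  have "tangle_eq T (swap_word [k, l]) (swap_word [l, k])" for T :: "'a strand list"
    using tangle_eq_exchange[of k m T "Cross Virtual" "Cross Virtual"] l
    by (simp add: swap_word_def)
  from tangle_eq_context[OF this, of S "swap_word u" "swap_word v"] show ?thesis using far by simp
next
  case (braid u k v)
  have "tangle_eq T (swap_word [k, k + 1, k]) (swap_word [k + 1, k, k + 1])" if "run S (swap_word u) = Some T" for T
  proof -
    have k: "fitting (length T) [k, k + 1, k]" "fitting (length T) [k + 1, k, k + 1]"
      using braid that by (auto simp: run_swap_word permute_props)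
    have "permute [k, k + 1, k] T = permute [k + 1, k, k + 1] T"
      using coxeter_step.braid[of "length T" "[]" k "[]"] k by (intro coxeter_step_permute) simp
    then have "run T (swap_word [k, k + 1, k]) = run T (swap_word [k + 1, k, k + 1])"
      using run_swap_word k by metis
    then show ?thesis
      by (intro tangle_eq_move disjI2) (simp_all add: generalized_move.V3[of k, simplified])
  qed
  then have "tangle_eq S (swap_word u @ swap_word [k, k + 1, k] @ swap_word v)
      (swap_word u @ swap_word [k + 1, k, k + 1] @ swap_word v)"
    by (rule tangle_eq_context)
  then show ?thesis using braid by simp
next
  case (cancel u k v)
  have "tangle_eq T (swap_word [k, k]) (swap_word [])" if "run S (swap_word u) = Some T" for T
  proof -
    have k: "fitting (length T) [k, k]"
      using cancel that by (auto simp: run_swap_word permute_props)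
    have "permute [k, k] T = permute [] T"
      using coxeter_step.cancel[of "length T" "[]" k "[]"] k by (intro coxeter_step_permute) simp
    then have "run T (swap_word [k, k]) = run T (swap_word [])"
      using run_swap_word[of T "[k, k]"] k by simp
    then show ?thesis
      by (intro tangle_eq_move disjI2) (simp_all add: generalized_move.V2)
  qed
  then have "tangle_eq S (swap_word u @ swap_word [k, k] @ swap_word v)
      (swap_word u @ swap_word [] @ swap_word v)"
    by (rule tangle_eq_context)
  then show ?thesis using cancel by simp
qed

lemma coxeter_eq_tangle_eq: "coxeter_eq (length S) a b \<Longrightarrow> tangle_eq S (swap_word a) (swap_word b)"
  by (induction rule: equivclp_induct)
    (auto intro: tangle_eq_trans tangle_eq_sym dest: coxeter_step_tangle_eq)

text \<open>A virtual braid carries no information beyond its permutation. Relations between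
  explicit virtual braids thus become evaluations on the test list.\<close>

lemma swap_word_tangle_eq:
  assumes "length S = n" "fitting n a" "fitting n b" "permute a [0..<n] = permute b [0..<n]"
  shows "tangle_eq S (swap_word a) (swap_word b)"
  using assms coxeter_eq_complete[of n a b "[0..<n]"] by (intro coxeter_eq_tangle_eq) auto


section \<open>Detour moves\<close>

definition shift :: "nat \<Rightarrow> 'l word \<Rightarrow> 'l word" where
  "shift k w = map (map_prod ((+) k) id) w"

lemma shift_simps [simp]:
  "shift k [] = []" "shift k ((i, p) # w) = (k + i, p) # shift k w"
  "shift k (v @ w) = shift k v @ shift k w"
  by (simp_all add: shift_def)

lemma shift_0: "shift 0 w = w"
  by (induction w) auto

lemma run_shift: "run L w = Some L' \<Longrightarrow> run (A @ L @ B) (shift (length A) w) = Some (A @ L' @ B)"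
proof (induction w arbitrary: L)
  case (Cons e w)
  obtain i p where e: "e = (i, p)" by (cases e)
  obtain M where M: "pass L (i, p) = Some M" "run M w = Some L'"
    using Cons.prems e by (auto simp: bind_eq_Some_conv)
  obtain C N N' E where "L = C @ N @ E" "length C = i" "length N = ends_below p"
    "pass N (0, p) = Some N'" "M = C @ N' @ E"
    using pass_split[OF M(1)] by metis
  then have "pass (A @ L @ B) (length A + i, p) = Some (A @ M @ B)"
    using pass_local[of N p "A @ C" "E @ B"] by simp
  then show ?case using Cons.IH[OF M(2)] e by simp
qed simp

lemma exchange_swap_left:
  "\<forall>k\<in>set ks. k + 2 \<le> m \<Longrightarrow> tangle_eq S ((m, p) # swap_word ks) (swap_word ks @ [(m, p)])"
proof (induction ks arbitrary: S)
  case (Cons k ks)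
  have "tangle_eq S ([(m, p), (k, Cross Virtual)] @ swap_word ks) ([(k, Cross Virtual), (m, p)] @ swap_word ks)"
  proof (rule tangle_eq_append_left)
    obtain j where "m = j + 2" "k \<le> j" using Cons.prems by (auto simp: le_iff_add ac_simps)
    then show "tangle_eq S [(m, p), (k, Cross Virtual)] [(k, Cross Virtual), (m, p)]"
      using tangle_eq_exchange[of k j S "Cross Virtual" p] by (auto intro: tangle_eq_sym)
  qed
  also have "tangle_eq S \<dots> ([(k, Cross Virtual)] @ swap_word ks @ [(m, p)])"
    using tangle_eq_append_right[of "(m, p) # swap_word ks" "swap_word ks @ [(m, p)]" S "[(k, Cross Virtual)]"] Cons
    by simp
  finally show ?case by simp
qed simp

lemma exchange_swap_right:
  "tangle_eq S ((i, p) # swap_word (map ((+) (i + ends_above p)) ns))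
     (swap_word (map ((+) (i + ends_below p)) ns) @ [(i, p)])"
proof (induction ns arbitrary: S)
  case (Cons k ns)
  have "tangle_eq S ([(i, p), (i + ends_above p + k, Cross Virtual)] @ swap_word (map ((+) (i + ends_above p)) ns))
     ([(i + ends_below p + k, Cross Virtual), (i, p)] @ swap_word (map ((+) (i + ends_above p)) ns))"
    using tangle_eq_exchange[of i "i + k" S p "Cross Virtual"]
    by (intro tangle_eq_append_left) (simp add: ac_simps)
  also have "tangle_eq S \<dots> ([(i + ends_below p + k, Cross Virtual)] @ swap_word (map ((+) (i + ends_below p)) ns) @ [(i, p)])"
    using tangle_eq_append_right[OF Cons.IH, of S "[(i + ends_below p + k, Cross Virtual)]"] by simp
  finally show ?case by simp
qed simp

lemma double_swap: "k + 1 < length S \<Longrightarrow> tangle_eq S (swap_word [k, k]) []"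
  using coxeter_step_tangle_eq[of S "[k, k]" "[]"] coxeter_step.cancel[of "length S" "[]" k "[]"] by simp

lemma run_cross_cup:
  "run S [(i, Cup x d), (i + 1, Cross c)] = run S [(i + 1, Cup x d), (i, Cross (switch c))]"
proof (cases "i < length S")
  case True
  then obtain A y B where "S = A @ y # B" "i = length A"
    by (metis id_take_nth_drop length_take less_imp_le_nat min.absorb2)
  then show ?thesis by (simp add: nth_append)
qed simp

lemma run_cross_cap:
  "run S [(i, Cross c), (i + 1, Cap)] = run S [(i + 1, Cross (switch c)), (i, Cap)]"
proof (cases "i + 2 < length S")
  case True
  then obtain A y B where S: "S = A @ y # B" "i = length A"
    by (metis add_lessD1 id_take_nth_drop length_take less_imp_le_nat min.absorb2)
  then obtain u v C where "B = u # v # C" using True by (cases B; cases "tl B") auto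
  then show ?thesis using S by (simp add: nth_append)
qed simp

lemma tangle_eq_cross_cup:
  "tangle_eq S [(i, Cup x d), (i + 1, Cross c)] [(i + 1, Cup x d), (i, Cross (switch c))]"
  by (intro tangle_eq_move disjI1 isotopy_move.cross_cup run_cross_cup)

lemma tangle_eq_cross_cap:
  "tangle_eq S [(i, Cross c), (i + 1, Cap)] [(i + 1, Cross (switch c)), (i, Cap)]"
  by (intro tangle_eq_move disjI1 isotopy_move.cross_cap run_cross_cap)

text \<open>One strand passes one singular level. At a minimum or maximum, one crossing is turned
  over the extremum and cancels the other; at a crossing this is \<open>V3\<close> or
  \<open>V4_first\<close>. A bar would require \<open>T1\<close>, which is not a move of virtual
  links.\<close>

lemma slide_piece:
  assumes "i < length S" "p \<noteq> Bar"
  shows "tangle_eq S ((i + 1, p) # swap_word [i..<i + ends_above p])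
    (swap_word [i..<i + ends_below p] @ [(i, p)])"
proof (cases p)
  case (Cup x d)
  have "tangle_eq S ([(i + 1, Cup x d), (i, Cross Virtual)] @ [(i + 1, Cross Virtual)])
      ([(i, Cup x d), (i + 1, Cross Virtual)] @ [(i + 1, Cross Virtual)])"
    by (intro tangle_eq_append_left tangle_eq_sym[OF tangle_eq_cross_cup[of _ _ _ _ Virtual, unfolded switch.simps]])
  also have "tangle_eq S \<dots> ([(i, Cup x d)] @ [])"
    using double_swap[of "i + 1" "take i S @ [(x, d), (x, \<not> d)] @ drop i S"] assms(1)
    by (auto intro!: tangle_eq_Cons split: if_splits)
  finally show ?thesis using Cup by (simp add: upt_conv_Cons numeral_2_eq_2)
next
  case Cap
  show ?thesis
  proof (cases "i + 2 < length S")
    case True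
    have "tangle_eq S ([(i, Cross Virtual)] @ [(i + 1, Cross Virtual), (i, Cap)])
        ([(i, Cross Virtual)] @ [(i, Cross Virtual), (i + 1, Cap)])"
      by (intro tangle_eq_append_right tangle_eq_sym[OF tangle_eq_cross_cap[of _ _ Virtual, unfolded switch.simps]])
    also have "\<dots> = swap_word [i, i] @ [(i + 1, Cap)]" by simp
    also have "tangle_eq S \<dots> ([] @ [(i + 1, Cap)])"
      using True by (intro tangle_eq_append_left double_swap) simp
    finally show ?thesis using Cap by (auto simp: upt_conv_Cons numeral_2_eq_2 intro: tangle_eq_sym)
  qed (use Cap in \<open>auto intro!: tangle_eq_None simp: upt_conv_Cons numeral_2_eq_2\<close>)
next
  case (Cross c)
  have run: "run S [(i, Cross Virtual), (i + 1, Cross Virtual), (i, Cross c)] =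
      run S [(i + 1, Cross c), (i, Cross Virtual), (i + 1, Cross Virtual)]"
  proof (cases "i + 2 < length S")
    case True
    then obtain A y B where S: "S = A @ y # B" "i = length A"
      by (metis add_lessD1 id_take_nth_drop length_take less_imp_le_nat min.absorb2)
    then obtain u v C where "B = u # v # C" using True by (cases B; cases "tl B") auto
    then show ?thesis using S by (simp add: nth_append)
  qed auto
  have "generalized_move [(i, Cross Virtual), (i + 1, Cross Virtual), (i, Cross c)]
      [(i + 1, Cross c), (i, Cross Virtual), (i + 1, Cross Virtual)]"
    using V3[of i] V4_first[of c i] by (cases "c = Virtual") (auto simp: classical_def)
  then have "tangle_eq S [(i, Cross Virtual), (i + 1, Cross Virtual), (i, Cross c)]
      [(i + 1, Cross c), (i, Cross Virtual), (i + 1, Cross Virtual)]"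
    using run by (intro tangle_eq_move) auto
  then show ?thesis using Cross by (auto simp: upt_conv_Cons numeral_2_eq_2 intro: tangle_eq_sym)
qed (use assms in simp)

text \<open>The strand \<open>y\<close> enters to the left of the tangle and leaves to its right,
  crossing over to that side either above or below \<open>w\<close>. The row of crossings is pushed
  down through the levels of \<open>w\<close> one at a time.\<close>

lemma detour:
  assumes "run L w = Some L'" "Bar \<notin> snd ` set w" "length A = i"
  shows "tangle_eq (A @ y # L @ B) (shift (i + 1) w @ swap_word [i..<i + length L'])
    (swap_word [i..<i + length L] @ shift i w)"
  using assms(1,2)
proof (induction w arbitrary: L)
  case (Cons e w)
  obtain j p where e: "e = (j, p)" by (cases e)
  obtain M where M: "pass L (j, p) = Some M" "run M w = Some L'"
    using Cons.prems e by (auto simp: bind_eq_Some_conv)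
  have p: "p \<noteq> Bar" "Bar \<notin> snd ` set w" using Cons.prems e by auto
  define k where "k = length L - j - ends_below p"
  have len: "length L = j + ends_below p + k" "length M = j + ends_above p + k"
    using pass_length[OF M(1)] by (auto simp: k_def)
  have pass: "pass (A @ y # L @ B) (i + 1 + j, p) = Some (A @ y # M @ B)"
    using run_shift[of L "[(j, p)]" M "A @ [y]" B] M assms(3) by simp
  \<comment> \<open>The row is cut into the crossings with strands to the left of the level, with
    its own ends, and with strands to its right. The outer parts pass by exchanges of height; only
    the middle part needs \<open>slide_piece\<close>.\<close>
  have upt: "[i..<i + (j + m + k)] = [i..<i + j] @ [i + j..<i + j + m] @ map ((+) (i + j + m)) [0..<k]" for m
  proof -
    have "map ((+) (i + j + m)) [0..<k] = map (\<lambda>a. a + (i + j + m)) [0..<k]"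
      by (simp add: add.commute)
    then have "map ((+) (i + j + m)) [0..<k] = [i + j + m..<i + j + m + k]"
      by (simp only: map_add_upt add.commute)
    then show ?thesis
      using upt_add_eq_append[of i "i + j" "m + k"] upt_add_eq_append[of "i + j" "i + j + m" k]
      by (simp add: add.assoc)
  qed
  have "tangle_eq (A @ y # L @ B) ([(i + 1 + j, p)] @ shift (i + 1) w @ swap_word [i..<i + length L'])
     ([(i + 1 + j, p)] @ swap_word [i..<i + length M] @ shift i w)"
    using Cons.IH[OF M(2) p(2)] pass by (intro tangle_eq_append[OF tangle_eq_refl]) simp_all
  also have "\<dots> = ((i + 1 + j, p) # swap_word [i..<i + j]) @ swap_word [i + j..<i + j + ends_above p]
      @ swap_word (map ((+) (i + j + ends_above p)) [0..<k]) @ shift i w"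
    by (simp add: len(2) upt)
  also have "tangle_eq (A @ y # L @ B) \<dots> ((swap_word [i..<i + j] @ [(i + 1 + j, p)]) @ swap_word [i + j..<i + j + ends_above p]
      @ swap_word (map ((+) (i + j + ends_above p)) [0..<k]) @ shift i w)"
    by (intro tangle_eq_append_left exchange_swap_left) auto
  also have "\<dots> = swap_word [i..<i + j] @ ((i + j + 1, p) # swap_word [i + j..<i + j + ends_above p])
      @ (swap_word (map ((+) (i + j + ends_above p)) [0..<k]) @ shift i w)"
    by (simp add: ac_simps)
  also have "tangle_eq (A @ y # L @ B) \<dots> (swap_word [i..<i + j] @ (swap_word [i + j..<i + j + ends_below p] @ [(i + j, p)])
      @ (swap_word (map ((+) (i + j + ends_above p)) [0..<k]) @ shift i w))"
  proof (rule tangle_eq_context)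
    fix T assume "run (A @ y # L @ B) (swap_word [i..<i + j]) = Some T"
    moreover have f: "fitting (length (A @ y # L @ B)) [i..<i + j]"
      using assms(3) len(1) by (auto simp: fitting_def)
    ultimately have "length T = length (A @ y # L @ B)"
      using run_swap_word[OF f] permute_props(1)[OF f] by simp
    then have "i + j < length T" using assms(3) len(1) by simp
    then show "tangle_eq T ((i + j + 1, p) # swap_word [i + j..<i + j + ends_above p])
        (swap_word [i + j..<i + j + ends_below p] @ [(i + j, p)])"
      using p(1) by (rule slide_piece)
  qed
  also have "\<dots> = (swap_word [i..<i + j] @ swap_word [i + j..<i + j + ends_below p])
      @ ((i + j, p) # swap_word (map ((+) (i + j + ends_above p)) [0..<k])) @ shift i w"
    by simp
  also have "tangle_eq (A @ y # L @ B) \<dots> ((swap_word [i..<i + j] @ swap_word [i + j..<i + j + ends_below p])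
      @ (swap_word (map ((+) (i + j + ends_below p)) [0..<k]) @ [(i + j, p)]) @ shift i w)"
    by (intro tangle_eq_context exchange_swap_right)
  also have "\<dots> = swap_word [i..<i + length L] @ shift i (e # w)"
    by (simp add: len(1) upt e)
  finally show ?case by (simp add: e)
qed simp

lemma commute_piece:
  "tangle_eq S ((i, p) # shift (i + ends_above p + k) v) (shift (i + ends_below p + k) v @ [(i, p)])"
proof (induction v arbitrary: S)
  case (Cons e v)
  obtain j q where e: "e = (j, q)" by (cases e)
  have "tangle_eq S ([(i, p), (i + ends_above p + k + j, q)] @ shift (i + ends_above p + k) v)
      ([(i + ends_below p + k + j, q), (i, p)] @ shift (i + ends_above p + k) v)"
    using tangle_eq_exchange[of i "i + k + j" S p q]
    by (intro tangle_eq_append_left) (simp add: ac_simps)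
  also have "tangle_eq S \<dots> ([(i + ends_below p + k + j, q)] @ shift (i + ends_below p + k) v @ [(i, p)])"
    using tangle_eq_append_right[OF Cons.IH, of S "[(i + ends_below p + k + j, q)]"] by simp
  finally show ?case by (simp add: e)
qed simp

text \<open>Tangles side by side slide past each other. The two shifts differ because
  \<open>w\<close> may change the number of strands to the left of \<open>v\<close>.\<close>

lemma commute_words:
  assumes "run L w = Some L'"
  shows "tangle_eq S (w @ shift (length L') v) (shift (length L) v @ w)"
  using assms
proof (induction w arbitrary: L S)
  case (Cons e w)
  obtain j p where e: "e = (j, p)" by (cases e)
  obtain M where M: "pass L (j, p) = Some M" "run M w = Some L'"
    using Cons.prems e by (auto simp: bind_eq_Some_conv)
  define k where "k = length L - j - ends_below p"
  have len: "length L = j + ends_below p + k" "length M = j + ends_above p + k"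
    using pass_length[OF M(1)] by (auto simp: k_def)
  have "tangle_eq S ([e] @ w @ shift (length L') v) ([e] @ shift (length M) v @ w)"
    by (intro tangle_eq_append_right Cons.IH M(2))
  also have "\<dots> = ((j, p) # shift (j + ends_above p + k) v) @ w" by (simp add: e len)
  also have "tangle_eq S \<dots> ((shift (j + ends_below p + k) v @ [(j, p)]) @ w)"
    by (intro tangle_eq_append_left commute_piece)
  finally show ?case by (simp add: e len)
qed simp

section \<open>Interchange of two pairs of strands\<close>

definition block_swap :: "nat \<Rightarrow> nat list" where
  "block_swap i = [i + 1, i + 2, i, i + 1]"

lemma swap_at_prefix: "swap_at (length A + k) (A @ xs) = A @ swap_at k xs"
  by (simp add: swap_at.simps nth_append)

lemma permute_prefix: "permute (map ((+) (length A)) ks) (A @ xs) = A @ permute ks xs"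
  by (induction ks arbitrary: xs) (simp_all add: swap_at_prefix)

lemma permute_block_swap:
  assumes "length A = i"
  shows "permute (block_swap i) (A @ [a, b, c, d] @ B) = A @ [c, d, a, b] @ B"
proof -
  have "block_swap i = map ((+) (length A)) [1, 2, 0, 1]" by (simp add: block_swap_def assms)
  moreover have "permute [1, 2, 0, 1] ([a, b, c, d] @ B) = [c, d, a, b] @ B"
    by (simp add: swap_at.simps numeral_eq_Suc)
  ultimately show ?thesis by (metis permute_prefix)
qed

lemma run_block_swap:
  assumes "length A = i"
  shows "run (A @ [a, b, c, d] @ B) (swap_word (block_swap i)) = Some (A @ [c, d, a, b] @ B)"
proof -
  have "fitting (length (A @ [a, b, c, d] @ B)) (block_swap i)"
    using assms by (simp add: block_swap_def)
  from run_swap_word[OF this] show ?thesis unfolding permute_block_swap[OF assms] .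
qed

lemma permute_block_swap_twice:
  assumes "i + 3 < length xs"
  shows "permute (block_swap i) (permute (block_swap i) xs) = xs"
proof -
  have "xs = take i xs @ [xs ! i, xs ! (i + 1), xs ! (i + 2), xs ! (i + 3)] @ drop (i + 4) xs"
    using assms by (simp add: Cons_nth_drop_Suc numeral_eq_Suc)
  then obtain A a b c d B where "xs = A @ [a, b, c, d] @ B" "length A = i"
    using assms by (metis add_lessD1 length_take less_imp_le_nat min.absorb2)
  then show ?thesis by (simp only: permute_block_swap)
qed

text \<open>The first two letters of \<open>block_swap\<close> carry \<open>y\<close> and the last
  two carry \<open>x\<close> across the right pair, so the slide consists of two successive
  detours.\<close>

lemma slide_block:
  assumes "run [a, b] w = Some [a', b']" "Bar \<notin> snd ` set w" "length A = i"
  shows "tangle_eq (A @ [x, y, a, b] @ B) (shift (i + 2) w @ swap_word (block_swap i))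
    (swap_word (block_swap i) @ shift i w)"
proof -
  have "tangle_eq (A @ [x, y, a, b] @ B) ((shift (i + 2) w @ swap_word [i + 1, i + 2]) @ swap_word [i, i + 1])
    ((swap_word [i + 1, i + 2] @ shift (i + 1) w) @ swap_word [i, i + 1])"
    using detour[OF assms(1,2), of "A @ [x]" "i + 1" y B] assms(3)
    by (intro tangle_eq_append_left) (simp add: upt_conv_Cons)
  also have "\<dots> = swap_word [i + 1, i + 2] @ (shift (i + 1) w @ swap_word [i, i + 1])" by simp
  also have "tangle_eq (A @ [x, y, a, b] @ B) \<dots> (swap_word [i + 1, i + 2] @ (swap_word [i, i + 1] @ shift i w))"
  proof (rule tangle_eq_append[OF tangle_eq_refl])
    fix T assume "run (A @ [x, y, a, b] @ B) (swap_word [i + 1, i + 2]) = Some T"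
    moreover have "fitting (length (A @ [x, y, a, b] @ B)) [i + 1, i + 2]"
      using assms(3) by simp
    moreover have "permute [i + 1, i + 2] (A @ [x, y, a, b] @ B) = A @ [x, a, b, y] @ B"
    proof -
      have "[i + 1, i + 2] = map ((+) (length A)) [1, 2]" by (simp add: assms(3))
      moreover have "permute [1, 2] ([x, y, a, b] @ B) = [x, a, b, y] @ B"
        by (simp add: swap_at.simps numeral_eq_Suc)
      ultimately show ?thesis by (metis permute_prefix)
    qed
    ultimately have "T = A @ [x, a, b, y] @ B"
      using run_swap_word by (metis option.inject)
    then show "tangle_eq T (shift (i + 1) w @ swap_word [i, i + 1]) (swap_word [i, i + 1] @ shift i w)"
      using detour[OF assms, of x "y # B"] by (simp add: upt_conv_Cons)
  qed
  finally show ?thesis by (simp add: block_swap_def)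
qed

text \<open>With \<open>Z\<close> the interchange and \<open>P\<close>, \<open>Q\<close> the left
  and right copies: the detour gives \<open>Q Z = Z P\<close>, conjugation by the involution
  \<open>Z\<close> gives \<open>P Z = Z Q\<close>, and \<open>P\<close>, \<open>Q\<close> commute as
  they lie side by side. Hence \<open>Z P Q = Z Q P = P Z P = P Q Z\<close>. Both pairs are
  \<open>a, b\<close>, so that a copy fits at either place.\<close>

lemma block_swap_commutes:
  assumes "run [a, b] w = Some [a, b]" "Bar \<notin> snd ` set w" "length A = i"
  shows "tangle_eq (A @ [a, b, a, b] @ B) (swap_word (block_swap i) @ shift i w @ shift (i + 2) w)
    (shift i w @ shift (i + 2) w @ swap_word (block_swap i))"
    (is "tangle_eq ?S (?Z @ ?P @ ?Q) _")
proof -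
  have run: "run ?S ?Z = Some ?S" "run ?S ?P = Some ?S" "run ?S ?Q = Some ?S"
    using run_block_swap[OF assms(3), of a b a b B] run_shift[OF assms(1), of A "a # b # B"]
      run_shift[OF assms(1), of "A @ [a, b]" B] assms(3) by simp_all
  have QZ: "tangle_eq ?S (?Q @ ?Z) (?Z @ ?P)"
    using slide_block[OF assms, of a b B] by simp
  have "permute (block_swap i @ block_swap i) [0..<length ?S] = permute [] [0..<length ?S]"
    using permute_block_swap_twice[of i "[0..<length ?S]"] assms(3) by simp
  moreover have "fitting (length ?S) (block_swap i)" using assms(3) by (simp add: block_swap_def)
  ultimately have ZZ: "tangle_eq ?S (?Z @ ?Z) []"
    using swap_word_tangle_eq[of ?S _ "block_swap i @ block_swap i" "[]"] by simp
  \<comment> \<open>\<open>slide_block\<close> treats a tangle below the interchange on the right.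
    For the one on the left, the trivial braid \<open>Z Z\<close> is inserted and the known relation
    is used inside.\<close>
  have PZ: "tangle_eq ?S (?P @ ?Z) (?Z @ ?Q)"
  proof -
    have "tangle_eq ?S ([] @ ?P @ ?Z) ((?Z @ ?Z) @ ?P @ ?Z)"
      by (rule tangle_eq_append_left[OF tangle_eq_sym[OF ZZ]])
    also have "\<dots> = ?Z @ (?Z @ ?P) @ ?Z" by simp
    also have "tangle_eq ?S \<dots> (?Z @ (?Q @ ?Z) @ ?Z)"
      by (rule tangle_eq_context_run[OF run(1) tangle_eq_sym[OF QZ]])
    also have "\<dots> = (?Z @ ?Q) @ (?Z @ ?Z) @ []" by simp
    also have "tangle_eq ?S \<dots> ((?Z @ ?Q) @ [] @ [])"
      using run ZZ by (intro tangle_eq_context_run[of ?S "?Z @ ?Q" ?S]) (simp_all only: run_append bind.bind_lunit)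
    finally show ?thesis by simp
  qed
  have PQ: "tangle_eq ?S (?P @ ?Q) (?Q @ ?P)"
    using commute_words[of "A @ [a, b]" ?P "A @ [a, b]" ?S w] run_shift[OF assms(1), of A "[]"] assms(3)
    by simp
  have "tangle_eq ?S (?Z @ (?P @ ?Q)) (?Z @ (?Q @ ?P))"
    by (rule tangle_eq_append_run[OF run(1) PQ])
  also have "\<dots> = (?Z @ ?Q) @ ?P" by simp
  also have "tangle_eq ?S \<dots> ((?P @ ?Z) @ ?P)"
    by (rule tangle_eq_append_left[OF tangle_eq_sym[OF PZ]])
  also have "\<dots> = ?P @ (?Z @ ?P)" by simp
  also have "tangle_eq ?S \<dots> (?P @ (?Q @ ?Z))"
    by (rule tangle_eq_append_run[OF run(2) tangle_eq_sym[OF QZ]])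
  finally show ?thesis .
qed

section \<open>Coverings of tangles without bars\<close>

lemma cover_from_append:
  assumes "run S u = Some T"
  shows "cover_from (length S) (u @ v) = cover_from (length S) u @ cover_from (length T) v"
  using assms
proof (induction u arbitrary: S)
  case (Cons e u)
  obtain i p where e: "e = (i, p)" by (cases e)
  obtain M where M: "pass S (i, p) = Some M" "run M u = Some T"
    using Cons.prems e by (auto simp: bind_eq_Some_conv)
  then have "length S + ends_above p - ends_below p = length M"
    using pass_length(2)[OF M(1)] by simp
  then show ?case using Cons.IH[OF M(2)] e by simp
qed simp

fun mirror_word :: "nat \<Rightarrow> 'l word \<Rightarrow> 'l word" where
  "mirror_word n [] = []"
| "mirror_word n ((i, p) # w) =
     (n - i - ends_below p, mirror p) # mirror_word (n + ends_above p - ends_below p) w"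

lemma mirror_ends [simp]: "ends_below (mirror p) = ends_below p" "ends_above (mirror p) = ends_above p"
  by (cases p; simp)+

lemma mirror_word_commute:
  assumes "run S w = Some T"
  shows "tangle_eq Q ((length S + i, p) # mirror_word (length S) w)
    (mirror_word (length S) w @ [(length T + i, p)])"
  using assms
proof (induction w arbitrary: S Q)
  case (Cons e w)
  obtain j q where e: "e = (j, q)" by (cases e)
  obtain M where M: "pass S (j, q) = Some M" "run M w = Some T"
    using Cons.prems e by (auto simp: bind_eq_Some_conv)
  define n where "n = length S - j - ends_below q"
  have n: "length S = j + ends_below q + n" "length M = j + ends_above q + n"
    using pass_length[OF M(1)] by (auto simp: n_def)
  have "tangle_eq Q ([(length S + i, p), (n, mirror q)] @ mirror_word (length M) w)
      ([(n, mirror q), (length M + i, p)] @ mirror_word (length M) w)"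
    using tangle_eq_exchange[of n "j + n + i" Q "mirror q" p]
    by (intro tangle_eq_append_left tangle_eq_sym[of Q "[(n, mirror q), (length M + i, p)]"])
      (simp add: n ac_simps)
  also have "tangle_eq Q \<dots> ([(n, mirror q)] @ mirror_word (length M) w @ [(length T + i, p)])"
    using tangle_eq_append_right[OF Cons.IH[OF M(2)], of Q "[(n, mirror q)]"] by simp
  finally show ?case by (simp add: e n ac_simps)
qed simp

text \<open>The cover interleaves the mirror image and the diagram level by level. Without bars the
  halves stay disjoint, so the levels of the right half rise above all of the mirror half, where
  they have \<open>length T\<close> mirror strands to their left.\<close>

lemma cover_from_split:
  assumes "run S w = Some T" "Bar \<notin> snd ` set w"
  shows "tangle_eq Q (cover_from (length S) w) (mirror_word (length S) w @ shift (length T) w)"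
  using assms
proof (induction w arbitrary: S Q)
  case (Cons e w)
  obtain i p where e: "e = (i, p)" by (cases e)
  obtain M where M: "pass S (i, p) = Some M" "run M w = Some T"
    using Cons.prems e by (auto simp: bind_eq_Some_conv)
  have len: "length S + ends_above p - ends_below p = length M"
    using pass_length(2)[OF M(1)] by simp
  have cover: "cover_from (length S) (e # w) =
      [(length S - i - ends_below p, mirror p), (length M + i, p)] @ cover_from (length M) w"
    using Cons.prems(2) len by (cases p) (auto simp: e)
  also have "tangle_eq Q \<dots> ([(length S - i - ends_below p, mirror p), (length M + i, p)]
      @ mirror_word (length M) w @ shift (length T) w)"
    using Cons.IH[OF M(2)] Cons.prems(2) by (intro tangle_eq_append_right) simp
  also have "\<dots> = [(length S - i - ends_below p, mirror p)] @
      ((length M + i, p) # mirror_word (length M) w) @ shift (length T) w"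
    by simp
  also have "tangle_eq Q \<dots> ([(length S - i - ends_below p, mirror p)] @
      (mirror_word (length M) w @ [(length T + i, p)]) @ shift (length T) w)"
    by (intro tangle_eq_context mirror_word_commute M(2))
  finally show ?case by (simp add: e len)
qed simp


section \<open>The two knots and their double coverings\<close>

text \<open>
  The first strand, directed downwards, runs through a classical loop; within the loop it passes
  once over the second strand, directed upwards, and crosses it back virtually.
\<close>

definition curl :: "'l \<Rightarrow> 'l word" where
  "curl x = [(1, Cup x False), (2, Cross Over), (2, Cross Virtual), (0, Cross Over), (1, Cap)]"

definition curls :: "'l \<Rightarrow> 'l word" where
  "curls x = shift 2 (curl x) @ curl x"

definition cups :: "'l \<Rightarrow> 'l word" where
  "cups x = [(0, Cup x False), (2, Cup x False)]"

definition bars :: "'l word" where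
  "bars = [(0, Bar), (2, Bar)]"

definition caps :: "'l word" where
  "caps = [(0, Cap), (0, Cap)]"

definition core_x :: "'l \<Rightarrow> 'l word" where
  "core_x x = cups x @ swap_word [1, 2, 1] @ bars @ curls x @ bars @ caps"

definition core_y :: "'l \<Rightarrow> 'l word" where
  "core_y x = cups x @ bars @ curls x @ bars @ swap_word [1, 2, 1] @ caps"

definition strands :: "'l \<Rightarrow> 'l strand list" where
  "strands x = [(x, False), (x, True), (x, False), (x, True)]"

lemma run_parts:
  "run [] (cups x) = Some (strands x)"
  "run (strands x) (swap_word [1, 2, 1]) = Some (strands x)"
  "run (strands x) bars = Some (strands x)"
  "run (strands x) (curls x) = Some (strands x)"
  "run (strands x) caps = Some []"
  by (simp_all add: cups_def strands_def bars_def curls_def curl_def caps_def numeral_eq_Suc)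

lemma run_core: "run [] (core_x x) = Some []" "run [] (core_y x) = Some []"
  by (simp_all only: core_x_def core_y_def run_append run_parts bind.bind_lunit)

definition cover_cups :: "'l \<Rightarrow> 'l word" where
  "cover_cups x = [(0, Cup x True), (2, Cup x False), (0, Cup x True), (6, Cup x False)]"

definition cover_caps :: "'l word" where
  "cover_caps = [(2, Cap), (2, Cap), (0, Cap), (0, Cap)]"

definition cover_strands :: "'l \<Rightarrow> 'l strand list" where
  "cover_strands x = rev (strands x) @ strands x"

text \<open>These are the values of the covering on four strands. The letters of
  \<open>cover_twist\<close> alternate between the mirror image and the diagram; in
  \<open>cover_bars\<close> the leading 3 belongs to the bar on strand 0 and the other nine letters
  to the bar on strand 2.\<close>

abbreviation "cover_twist \<equiv> [1, 5, 0, 6, 1, 5 :: nat]"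
abbreviation "cover_bars \<equiv> [3, 1, 2, 3, 4, 5, 4, 3, 2, 1 :: nat]"

lemma cover_parts:
  "cover_from 0 (cups x) = cover_cups x"
  "cover_from 4 (swap_word [1, 2, 1]) = swap_word cover_twist"
  "cover_from 4 bars = swap_word cover_bars"
  "cover_from 4 caps = cover_caps"
  by (simp_all add: cups_def cover_cups_def bars_def caps_def cover_caps_def bar_cover_def swap_word_def
      Let_def upt_rec[of _ "6"] upt_rec[of _ "5"] upt_rec[of _ 4] numeral_eq_Suc)

lemma length_strands [simp]: "length (strands x) = 4" "length (cover_strands x) = 8"
  by (simp_all add: strands_def cover_strands_def)

lemma cover_append_strands:
  assumes "run (strands x) u = Some (strands x)"
  shows "cover_from 4 (u @ v) = cover_from 4 u @ cover_from 4 v"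
  using cover_from_append[OF assms, of v] by simp

lemma double_cover_core:
  "double_cover (core_x x) = cover_cups x @ swap_word cover_twist @ swap_word cover_bars @
     cover_from 4 (curls x) @ swap_word cover_bars @ cover_caps"
  "double_cover (core_y x) = cover_cups x @ swap_word cover_bars @
     cover_from 4 (curls x) @ swap_word cover_bars @ swap_word cover_twist @ cover_caps"
proof -
  have "cover_from 0 (cups x @ v) = cover_cups x @ cover_from 4 v" for v
    using cover_from_append[OF run_parts(1)[of x], of v] by (simp add: cover_parts)
  then show
    "double_cover (core_x x) = cover_cups x @ swap_word cover_twist @ swap_word cover_bars @
     cover_from 4 (curls x) @ swap_word cover_bars @ cover_caps"
    "double_cover (core_y x) = cover_cups x @ swap_word cover_bars @
     cover_from 4 (curls x) @ swap_word cover_bars @ swap_word cover_twist @ cover_caps"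
    by (simp_all only: double_cover_def core_x_def core_y_def
        cover_append_strands[OF run_parts(2)] cover_append_strands[OF run_parts(3)]
        cover_append_strands[OF run_parts(4)] cover_parts)
qed

lemma run_cover_swaps:
  "run (cover_strands x) (swap_word cover_twist) = Some (cover_strands x)"
  "run (cover_strands x) (swap_word cover_bars) = Some (cover_strands x)"
  "run (cover_strands x) (swap_word (block_swap 0)) = Some (cover_strands x)"
  "run (cover_strands x) (swap_word (block_swap 4)) = Some (cover_strands x)"
  "run (cover_strands x) cover_caps = Some []"
  "run [] (cover_cups x) = Some (cover_strands x)"
  by (simp_all add: cover_strands_def strands_def block_swap_def cover_cups_def cover_caps_def numeral_eq_Suc)

text \<open>
  As permutations, \<open>cover_twist\<close> is the product of \<open>block_swap 4\<close> and of the conjugate of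
  \<open>block_swap 0\<close> by \<open>cover_bars\<close>.
\<close>

lemma cover_swap_relations:
  "tangle_eq (cover_strands x) (swap_word (cover_twist @ cover_bars))
     (swap_word (block_swap 4 @ cover_bars @ block_swap 0))"
  "tangle_eq (cover_strands x) (swap_word (block_swap 0 @ cover_bars))
     (swap_word (cover_bars @ cover_twist @ block_swap 4))"
  by (rule swap_word_tangle_eq[where n = 8]; simp add: block_swap_def; code_simp)+

definition mirror_curl :: "'l \<Rightarrow> 'l word" where
  "mirror_curl x = [(1, Cup x True), (0, Cross Over), (0, Cross Virtual), (2, Cross Over), (1, Cap)]"

text \<open>Reflection takes the right curl, which comes first in height, to the leftmost
  place.\<close>

lemma cover_curls:
  "tangle_eq S (cover_from 4 (curls x))
     (mirror_curl x @ shift 2 (mirror_curl x) @ shift 4 (curls x))"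
proof -
  have "mirror_word 4 (curls x) = mirror_curl x @ shift 2 (mirror_curl x)"
    by (simp add: curls_def curl_def mirror_curl_def)
  moreover have "Bar \<notin> snd ` set (curls x)"
    by (auto simp: curls_def curl_def shift_def)
  ultimately show ?thesis
    using cover_from_split[OF run_parts(4)[of x], of S] by simp
qed

lemma run_mirror_curl: "run [(x, True), (x, False)] (mirror_curl x) = Some [(x, True), (x, False)]"
  by (simp add: mirror_curl_def numeral_eq_Suc)

lemma run_mirror_curls:
  "run (cover_strands x) (mirror_curl x @ shift 2 (mirror_curl x)) = Some (cover_strands x)"
  using run_shift[OF run_mirror_curl[of x], of "[]" "(x, True) # (x, False) # strands x"]
    run_shift[OF run_mirror_curl[of x], of "[(x, True), (x, False)]" "strands x"]
  by (simp add: run_append cover_strands_def strands_def shift_0 numeral_2_eq_2)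

lemma run_cover_curls: "run (cover_strands x) (cover_from 4 (curls x)) = Some (cover_strands x)"
proof -
  have "run (cover_strands x) (shift 4 (curls x)) = Some (cover_strands x)"
    using run_shift[OF run_parts(4)[of x], of "rev (strands x)" "[]"] by (simp add: cover_strands_def)
  then have "run (cover_strands x) ((mirror_curl x @ shift 2 (mirror_curl x)) @ shift 4 (curls x)) = Some (cover_strands x)"
    by (simp only: run_append[of _ "mirror_curl x @ shift 2 (mirror_curl x)"] run_mirror_curls bind.bind_lunit)
  then show ?thesis
    using tangle_eq_run[OF cover_curls[of "cover_strands x" x]] by simp
qed

text \<open>The mirror images of the two curls are equal tangles on equal pairs of strands, so the
  interchange passes them by \<open>block_swap_commutes\<close>; the curls of the other half lie
  entirely to its right.\<close>

lemma block_swap_cover_curls: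
  "tangle_eq (cover_strands x) (swap_word (block_swap 0) @ cover_from 4 (curls x))
     (cover_from 4 (curls x) @ swap_word (block_swap 0))"
proof -
  have mirror: "Bar \<notin> snd ` set (mirror_curl x)" by (simp add: mirror_curl_def)
  let ?Z = "swap_word (block_swap 0)" and ?M = "mirror_curl x @ shift 2 (mirror_curl x)"
  have "tangle_eq (cover_strands x) (?Z @ cover_from 4 (curls x)) (?Z @ ?M @ shift 4 (curls x))"
    using cover_curls by (intro tangle_eq_append_right) simp
  also have "\<dots> = (?Z @ ?M) @ shift 4 (curls x)" by simp
  also have "tangle_eq (cover_strands x) \<dots> ((?M @ ?Z) @ shift 4 (curls x))"
    using block_swap_commutes[OF run_mirror_curl[of x], of "[]" 0 "strands x"] mirror
    by (intro tangle_eq_append_left) (simp add: shift_0 cover_strands_def strands_def numeral_2_eq_2)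
  also have "\<dots> = ?M @ ?Z @ shift 4 (curls x)" by simp
  also have "tangle_eq (cover_strands x) \<dots> (?M @ shift 4 (curls x) @ ?Z)"
    using commute_words[of "strands x" "swap_word (block_swap 0)" "strands x" _ "curls x"]
    by (intro tangle_eq_append_right) (simp add: strands_def block_swap_def numeral_eq_Suc)
  also have "\<dots> = (?M @ shift 4 (curls x)) @ ?Z" by simp
  also have "tangle_eq (cover_strands x) \<dots> (cover_from 4 (curls x) @ ?Z)"
    using tangle_eq_append_left[OF tangle_eq_sym[OF cover_curls[of "cover_strands x" x]], of ?Z] by simp
  finally show ?thesis .
qed

text \<open>The crossings slide the last minimum from place 6 to 5 and on to 4, to the left of the
  other minimum of its half. Both minima have the same label and directions, so exchanging their
  heights restores the original word.\<close>

lemma cups_absorb: "tangle_eq [] (cover_cups x @ swap_word (block_swap 4)) (cover_cups x)"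
proof -
  let ?u = "[(0, Cup x True)]" and ?a = "(0, Cup x True)" and ?b = "\<lambda>i. (i :: nat, Cup x False)"
  have mid: "tangle_eq S [?b 2, ?a] [?a, ?b 4]" for S
    using tangle_eq_sym[OF tangle_eq_exchange[of 0 2 S "Cup x True" "Cup x False"]] by simp
  have norm: "tangle_eq [] (?u @ [?b 2, ?a] @ [?b i]) (?u @ [?a, ?b 4] @ [?b i])" for i
    by (intro tangle_eq_context mid)
  have "tangle_eq [] (cover_cups x @ swap_word (block_swap 4))
      ([?a, ?b 2, ?a] @ ([?b 6] @ swap_word [5, 6]) @ swap_word [4, 5])"
    by (simp add: cover_cups_def block_swap_def)
  also have "tangle_eq [] \<dots> ([?a, ?b 2, ?a] @ [?b 5] @ swap_word [4, 5])"
  proof (rule tangle_eq_context)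
    fix T assume "run [] [?a, ?b 2, ?a] = Some T"
    then have "5 < length T" by (auto simp: bind_eq_Some_conv split: if_splits)
    then show "tangle_eq T ([?b 6] @ swap_word [5, 6]) [?b 5]"
      using slide_piece[of 5 T "Cup x False"] by (simp add: upt_conv_Cons)
  qed
  also have "\<dots> = [?a, ?b 2, ?a] @ ([?b 5] @ swap_word [4, 5]) @ []" by simp
  also have "tangle_eq [] \<dots> ([?a, ?b 2, ?a] @ [?b 4] @ [])"
  proof (rule tangle_eq_context)
    fix T assume "run [] [?a, ?b 2, ?a] = Some T"
    then have "4 < length T" by (auto simp: bind_eq_Some_conv split: if_splits)
    then show "tangle_eq T ([?b 5] @ swap_word [4, 5]) [?b 4]"
      using slide_piece[of 4 T "Cup x False"] by (simp add: upt_conv_Cons)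
  qed
  also have "tangle_eq [] \<dots> ([?a, ?a] @ [?b 4, ?b 4])"
    using norm[of 4] by simp
  also have "tangle_eq [] \<dots> ([?a, ?a] @ [?b 4, ?b 6])"
    using tangle_eq_sym[OF tangle_eq_exchange[of 4 4 _ "Cup x False" "Cup x False"]]
    by (intro tangle_eq_append_right) simp
  also have "tangle_eq [] \<dots> (cover_cups x)"
    using tangle_eq_sym[OF norm[of 6]] by (simp add: cover_cups_def)
  finally show ?thesis .
qed

text \<open>The counterpart for maxima. Since \<open>cover_caps\<close> begins with a maximum of the
  mirror half, the crossings are raised above it beforehand, which lowers their places by two. They
  then move the next maximum from place 2 to 4.\<close>

lemma caps_absorb: "tangle_eq (cover_strands x) (swap_word (block_swap 4) @ cover_caps) cover_caps"
proof -
  let ?c = "\<lambda>i. (i :: nat, Cap)"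
  have cap: "tangle_eq S [?c 2, ?c 0] [?c 0, ?c 0]" for S
    using tangle_eq_sym[OF tangle_eq_exchange[of 0 0 S Cap Cap]] by (simp add: numeral_2_eq_2)
  have len: "5 < length T" if "pass (cover_strands x) (?c 2) = Some T" for T
    using pass_length(2)[OF that] by simp
  have "tangle_eq (cover_strands x) (swap_word (block_swap 4) @ cover_caps)
      ((swap_word [5, 6, 4, 5] @ [?c 2]) @ [?c 2, ?c 0, ?c 0])"
    by (simp add: cover_caps_def block_swap_def)
  also have "tangle_eq (cover_strands x) \<dots> ((?c 2 # swap_word [3, 4, 2, 3]) @ [?c 2, ?c 0, ?c 0])"
    using exchange_swap_right[of "cover_strands x" 2 Cap "[1, 2, 0, 1]"]
    by (intro tangle_eq_append_left, intro tangle_eq_sym[of _ "?c 2 # swap_word [3, 4, 2, 3]"]) simp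
  also have "\<dots> = (?c 2 # swap_word [3, 4]) @ (swap_word [2, 3] @ [?c 2]) @ [?c 0, ?c 0]" by simp
  also have "tangle_eq (cover_strands x) \<dots> ((?c 2 # swap_word [3, 4]) @ [?c 3] @ [?c 0, ?c 0])"
  proof (rule tangle_eq_context)
    fix T assume "run (cover_strands x) (?c 2 # swap_word [3, 4]) = Some T"
    then have "2 < length T" by (simp add: cover_strands_def strands_def numeral_eq_Suc) auto
    then show "tangle_eq T (swap_word [2, 3] @ [?c 2]) [?c 3]"
      using tangle_eq_sym[OF slide_piece[of 2 T Cap]] by (simp add: upt_conv_Cons)
  qed
  also have "\<dots> = [?c 2] @ (swap_word [3, 4] @ [?c 3]) @ [?c 0, ?c 0]" by simp
  also have "tangle_eq (cover_strands x) \<dots> ([?c 2] @ [?c 4] @ [?c 0, ?c 0])"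
  proof (rule tangle_eq_context)
    fix T assume "run (cover_strands x) [?c 2] = Some T"
    then have "3 < length T" using len by fastforce
    then show "tangle_eq T (swap_word [3, 4] @ [?c 3]) [?c 4]"
      using tangle_eq_sym[OF slide_piece[of 3 T Cap]] by (simp add: upt_conv_Cons)
  qed
  also have "\<dots> = [?c 2] @ [?c 4, ?c 0] @ [?c 0]" by simp
  also have "tangle_eq (cover_strands x) \<dots> ([?c 2] @ [?c 0, ?c 2] @ [?c 0])"
    using tangle_eq_sym[OF tangle_eq_exchange[of 0 2 _ Cap Cap]] by (intro tangle_eq_context) simp
  also have "\<dots> = [?c 2, ?c 0] @ [?c 2, ?c 0]" by simp
  also have "tangle_eq (cover_strands x) \<dots> ([?c 2, ?c 0] @ [?c 0, ?c 0])"
    by (intro tangle_eq_append_right cap)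
  also have "\<dots> = [?c 2] @ [?c 0, ?c 0] @ [?c 0]" by simp
  also have "tangle_eq (cover_strands x) \<dots> ([?c 2] @ [?c 2, ?c 0] @ [?c 0])"
    by (intro tangle_eq_context tangle_eq_sym[OF cap])
  finally show ?thesis by (simp add: cover_caps_def)
qed

lemma double_covers_tangle_eq: "tangle_eq [] (double_cover (core_x x)) (double_cover (core_y x))"
proof -
  let ?C = "cover_cups x" and ?D = "cover_caps" and ?X = "cover_from 4 (curls x)"
    and ?t = "swap_word cover_twist" and ?b = "swap_word cover_bars"
    and ?z = "swap_word (block_swap 0)" and ?h = "swap_word (block_swap 4)"
  note run = run_cover_swaps[of x] run_cover_curls[of x]
  have "tangle_eq [] (?C @ (?t @ ?b) @ ?X @ ?b @ ?D) (?C @ (?h @ ?b @ ?z) @ ?X @ ?b @ ?D)"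
    by (rule tangle_eq_context_run[OF run(6) cover_swap_relations(1)[unfolded swap_word_simps(3)]])
  then have 1: "tangle_eq [] (?C @ ?t @ ?b @ ?X @ ?b @ ?D) (?C @ ?h @ ?b @ ?z @ ?X @ ?b @ ?D)"
    by (simp only: append_assoc)
  have "tangle_eq [] ((?C @ ?h) @ ?b @ ?z @ ?X @ ?b @ ?D) (?C @ ?b @ ?z @ ?X @ ?b @ ?D)"
    by (rule tangle_eq_append_left[OF cups_absorb])
  then have 2: "tangle_eq [] (?C @ ?h @ ?b @ ?z @ ?X @ ?b @ ?D) (?C @ ?b @ ?z @ ?X @ ?b @ ?D)"
    by (simp only: append_assoc)
  have "run [] (?C @ ?b) = Some (cover_strands x)"
    by (simp only: run run_append bind.bind_lunit)
  from tangle_eq_context_run[OF this block_swap_cover_curls]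
  have "tangle_eq [] ((?C @ ?b) @ (?z @ ?X) @ ?b @ ?D) ((?C @ ?b) @ (?X @ ?z) @ ?b @ ?D)" .
  then have 3: "tangle_eq [] (?C @ ?b @ ?z @ ?X @ ?b @ ?D) (?C @ ?b @ ?X @ ?z @ ?b @ ?D)"
    by (simp only: append_assoc)
  have "run [] (?C @ ?b @ ?X) = Some (cover_strands x)"
    by (simp only: run run_append bind.bind_lunit)
  from tangle_eq_context_run[OF this cover_swap_relations(2)[unfolded swap_word_simps(3)]]
  have "tangle_eq [] ((?C @ ?b @ ?X) @ (?z @ ?b) @ ?D) ((?C @ ?b @ ?X) @ (?b @ ?t @ ?h) @ ?D)" .
  then have 4: "tangle_eq [] (?C @ ?b @ ?X @ ?z @ ?b @ ?D) (?C @ ?b @ ?X @ ?b @ ?t @ ?h @ ?D)"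
    by (simp only: append_assoc)
  have "run [] (?C @ ?b @ ?X @ ?b @ ?t) = Some (cover_strands x)"
    by (simp only: run run_append bind.bind_lunit)
  from tangle_eq_append_run[OF this caps_absorb]
  have 5: "tangle_eq [] (?C @ ?b @ ?X @ ?b @ ?t @ ?h @ ?D) (?C @ ?b @ ?X @ ?b @ ?t @ ?D)"
    by (simp only: append_assoc)
  show ?thesis unfolding double_cover_core
    by (rule tangle_eq_trans[OF 1 tangle_eq_trans[OF 2 tangle_eq_trans[OF 3 tangle_eq_trans[OF 4 5]]]])
qed


section \<open>Colourings\<close>

declare add_bit_eq_xor [simp del]

text \<open>
  The colours form a twisted biquandle of four elements for which over- and undercrossings behave
  alike.  On strands directed downwards the two coordinates are exchanged; in this normalization
  the rule at a crossing does not depend on the directions either, and the exchange shows up at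
  minima and maxima instead.
\<close>

type_synonym colour = "bit \<times> bit"

text \<open>The classical rule is linear and an involution on pairs of colours; hence
  \<open>R2\<close> holds although \<open>Over\<close> and \<open>Under\<close> share the
  rule.\<close>

fun cross_colours :: "crossing \<Rightarrow> colour \<Rightarrow> colour \<Rightarrow> colour list" where
  "cross_colours Virtual a b = [b, a]"
| "cross_colours _ (p, q) (r, s) = [(p + q + r, p + r + s), (p + q + s, q + r + s)]"

text \<open>The summands 1 create the obstruction: with a mere exchange of coordinates, a bar on one
  branch of a minimum would give both branches the same second coordinate, as a curl
  requires.\<close>

fun bar_colour :: "colour \<Rightarrow> colour" where
  "bar_colour (p, q) = (q + 1, p + 1)"

text \<open>Sets are needed because a minimum may take any of the four colours, while a maximum with
  unmatched colours leaves none.\<close>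

fun colour_pass :: "colour list \<Rightarrow> nat \<times> 'l piece \<Rightarrow> colour list set" where
  "colour_pass C (i, Cup x d) =
     (if i \<le> length C then \<Union>a. {take i C @ [a, prod.swap a] @ drop i C} else {})"
| "colour_pass C (i, Cap) =
     (if i + 1 < length C \<and> C ! (i + 1) = prod.swap (C ! i) then {take i C @ drop (i + 2) C} else {})"
| "colour_pass C (i, Cross c) =
     (if i + 1 < length C then {take i C @ cross_colours c (C ! i) (C ! (i + 1)) @ drop (i + 2) C} else {})"
| "colour_pass C (i, Bar) = (if i < length C then {C[i := bar_colour (C ! i)]} else {})"

fun colour_run :: "colour list \<Rightarrow> 'l word \<Rightarrow> colour list set" where
  "colour_run C [] = {C}"
| "colour_run C (e # w) = (\<Union>D\<in>colour_pass C e. colour_run D w)"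

definition colourable :: "'l word \<Rightarrow> bool" where
  "colourable D \<longleftrightarrow> [] \<in> colour_run [] D"

lemma colour_run_append: "colour_run C (u @ v) = (\<Union>D\<in>colour_run C u. colour_run D v)"
  by (induction u arbitrary: C) auto

lemma length_cross_colours [simp]: "length (cross_colours c a b) = 2"
  by (cases "(c, a, b)" rule: cross_colours.cases) auto

lemma colour_pass_length:
  assumes "D \<in> colour_pass C (i, p)"
  shows "i + ends_below p \<le> length C" "length D + ends_below p = length C + ends_above p"
  using assms by (cases p; auto split: if_splits)+

lemma colour_run_length:
  "run S w = Some T \<Longrightarrow> length C = length S \<Longrightarrow> D \<in> colour_run C w \<Longrightarrow> length D = length T"
proof (induction w arbitrary: S C)
  case (Cons e w)
  obtain i p where e: "e = (i, p)" by (cases e)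
  obtain M where M: "pass S (i, p) = Some M" "run M w = Some T"
    using Cons.prems(1) e by (auto simp: bind_eq_Some_conv)
  obtain E where E: "E \<in> colour_pass C (i, p)" "D \<in> colour_run E w"
    using Cons.prems(3) e by auto
  have "length E = length M"
    using pass_length(2)[OF M(1)] colour_pass_length(2)[OF E(1)] Cons.prems(2) by simp
  then show ?case using Cons.IH M E by blast
qed simp

lemma colour_pass_local:
  assumes "length L = ends_below p"
  shows "colour_pass (A @ L @ B) (length A, p) = (\<lambda>L'. A @ L' @ B) ` colour_pass L (0, p)"
  using assms
  by (cases p) (auto simp: nth_append length_Suc_conv numeral_2_eq_2 image_image simp del: split_paired_All split_paired_Ex)

lemma colour_exchange:
  assumes "i \<le> j"
  shows "colour_run C [(i, p), (j + ends_above p, q)] = colour_run C [(j + ends_below p, q), (i, p)]"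
proof (cases "j + ends_below p + ends_below q \<le> length C")
  case True
  have "i + ends_below p \<le> j + ends_below p" using assms by simp
  then obtain A L B M E where C: "C = A @ L @ B @ M @ E" and
    "length A = i" "length L = ends_below p" "length B = j + ends_below p - (i + ends_below p)"
    "length M = ends_below q"
    using True by (rule split_two_blocks)
  then have l: "length A = i" "length L = ends_below p" "length B = j - i" "length M = ends_below q"
    by simp_all
  have 1: "colour_pass (A @ L @ B @ N @ E) (i, p) = (\<lambda>L'. A @ L' @ B @ N @ E) ` colour_pass L (0, p)" for N
    using colour_pass_local[OF l(2), of A "B @ N @ E"] l by simp
  have 2: "colour_pass (A @ L' @ B @ M @ E) (j + length L', q) = (\<lambda>M'. A @ L' @ B @ M' @ E) ` colour_pass M (0, q)" for L'
    using colour_pass_local[OF l(4), of "A @ L' @ B" E] l assms by (simp add: add.commute)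
  have 3: "length L' = ends_above p" if "L' \<in> colour_pass L (0, p)" for L'
    using colour_pass_length(2)[OF that] l by simp
  have "colour_run C [(i, p), (j + ends_above p, q)] =
      (\<Union>L'\<in>colour_pass L (0, p). colour_pass (A @ L' @ B @ M @ E) (j + length L', q))"
    unfolding C using 3 by (simp add: 1)
  also have "\<dots> = (\<Union>L'\<in>colour_pass L (0, p). \<Union>M'\<in>colour_pass M (0, q). {A @ L' @ B @ M' @ E})"
    by (simp add: 2 UN_singleton image_def) blast
  also have "\<dots> = (\<Union>M'\<in>colour_pass M (0, q). \<Union>L'\<in>colour_pass L (0, p). {A @ L' @ B @ M' @ E})"
    by blast
  also have "\<dots> = colour_run C [(j + ends_below p, q), (i, p)]"
    unfolding C using 2[of L] l(2) by (auto simp: 1)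
  finally show ?thesis .
next
  case False
  have 1: "colour_pass C (j + ends_below p, q) = {}"
    using colour_pass_length(1)[of _ C "j + ends_below p" q] False by fastforce
  have "colour_pass T (j + ends_above p, q) = {}" if "T \<in> colour_pass C (i, p)" for T
    using colour_pass_length(1)[of _ T "j + ends_above p" q] colour_pass_length(2)[OF that] False
    by fastforce
  then show ?thesis using 1 by simp
qed

lemma colour_run_simps [simp]:
  "colour_run C ((i, Cup x d) # w) =
     (if i \<le> length C then \<Union>a. colour_run (take i C @ [a, prod.swap a] @ drop i C) w else {})"
  "colour_run C ((i, Cap) # w) =
     (if i + 1 < length C \<and> C ! (i + 1) = prod.swap (C ! i)
      then colour_run (take i C @ drop (i + 2) C) w else {})"
  "colour_run C ((i, Cross c) # w) =
     (if i + 1 < length C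
      then colour_run (take i C @ cross_colours c (C ! i) (C ! (i + 1)) @ drop (i + 2) C) w else {})"
  "colour_run C ((i, Bar) # w) =
     (if i < length C then colour_run (C[i := bar_colour (C ! i)]) w else {})"
  by auto

declare colour_run.simps(2) [simp del]

section \<open>Invariance of colourings under the moves\<close>

lemma UNIV_colour: "(UNIV :: colour set) = {(0, 0), (0, 1), (1, 0), (1, 1)}"
proof -
  have "(UNIV :: bit set) = {0, 1}" by (auto intro: bit.exhaust)
  then show ?thesis by (auto simp flip: UNIV_Times_UNIV)
qed

lemma bit_cancel [simp]: "a + a = (0 :: bit)" "a + (a + b) = (b :: bit)"
  by (cases a; cases b; simp)+

lemma split_at_1:
  assumes "i < length C" obtains A a B where "C = A @ a # B" "i = length A"
  using assms by (metis id_take_nth_drop length_take less_imp_le_nat min.absorb2)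

lemma split_at_3:
  assumes "i + 2 < length C" obtains A a b c B where "C = A @ a # b # c # B" "i = length A"
proof -
  have "i + 1 < length C" using assms by simp
  then obtain A a b B where 1: "C = A @ a # b # B" "i = length A" by (rule split_at_pair)
  then obtain c E where "B = c # E" using assms by (cases B) auto
  then show thesis using 1 that by blast
qed

lemma nth_append_Suc: "(A @ B) ! Suc (length A) = B ! 1" "(A @ B) ! Suc (Suc (length A)) = B ! 2"
  by (simp_all add: nth_append numeral_2_eq_2)

lemmas colour_simps = nth_append_Suc numeral_2_eq_2 add.assoc add.commute add.left_commute

lemma cross_colours_classical:
  "classical c \<Longrightarrow> cross_colours c a b =
     [(fst a + snd a + fst b, fst a + fst b + snd b), (fst a + snd a + snd b, snd a + fst b + snd b)]"
  by (cases c; cases a; cases b) (auto simp: classical_def)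

lemma classical_cases: "classical c \<Longrightarrow> c = Over \<or> c = Under"
  by (cases c) (auto simp: classical_def)

text \<open>Equality of the whole sets of outgoing colours, for given incoming ones, carries over to
  any context. The two runs guarantee that all places exist: outside the list an empty right-hand
  side would still accept the colours while the left-hand side rejects them.\<close>

lemma colour_isotopy_move:
  assumes "isotopy_move l r" "run S l = Some T" "run S r = Some T'" "length C = length S"
  shows "colour_run C l = colour_run C r"
  using assms(1)
proof cases
  case (exchange i j p q)
  then show ?thesis using colour_exchange[of i j C p q] by simp
next
  case (cancel_right i x d)
  then have "i < length C" using assms by (auto simp: bind_eq_Some_conv split: if_splits)
  then obtain A a B where "C = A @ a # B" "i = length A" by (rule split_at_1)
  then show ?thesis using cancel_right
    by (auto simp: colour_simps)
next
  case (cancel_left i x d)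
  then have "i < length C" using assms by (auto simp: bind_eq_Some_conv split: if_splits)
  then obtain A a B where "C = A @ a # B" "i = length A" by (rule split_at_1)
  then show ?thesis using cancel_left
    by (auto simp: colour_simps)
next
  case (cross_cap i c)
  then have "i + 2 < length C" using assms by (auto simp: bind_eq_Some_conv split: if_splits)
  then obtain A a b e B where "C = A @ a # b # e # B" "i = length A" by (rule split_at_3)
  then show ?thesis using cross_cap by (cases c; cases a; cases b; cases e) (auto simp: colour_simps)
next
  case (cross_cup i x d c)
  then have "i < length C" using assms by (auto simp: bind_eq_Some_conv split: if_splits)
  then obtain A a B where "C = A @ a # B" "i = length A" by (rule split_at_1)
  then show ?thesis using cross_cup by (cases c; cases a) (auto simp: colour_simps)
next
  case (bar_cap i)
  then have "i + 1 < length C" using assms by (auto simp: bind_eq_Some_conv split: if_splits)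
  then obtain A a b B where "C = A @ a # b # B" "i = length A" by (rule split_at_pair)
  then show ?thesis using bar_cap by (cases a; cases b) (auto simp: colour_simps)
next
  case (bar_cup i x d)
  then have "i \<le> length C" using assms by (auto simp: bind_eq_Some_conv split: if_splits)
  then obtain A B where C: "C = A @ B" "i = length A"
    by (metis append_take_drop_id length_take min.absorb2)
  \<comment> \<open>\<open>F\<close> and \<open>G\<close> are the colours with the bar on the left
    and on the right branch. Recolouring the minimum by the involution \<open>bar_colour\<close>
    matches them.\<close>
  define F G where "F a = A @ [bar_colour a, prod.swap a] @ B" and
    "G a = A @ [a, bar_colour (prod.swap a)] @ B" for a
  have "F a = G (bar_colour a)" "G a = F (bar_colour a)" for a
    by (cases a; simp add: F_def G_def add.assoc)+
  then have "(\<Union>a. {F a}) = (\<Union>a. {G a})" by blast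
  then show ?thesis using bar_cup C
    by (simp add: F_def G_def colour_simps list_update_append)
qed

lemma colour_generalized_move:
  assumes "generalized_move l r" "run S l = Some T" "run S r = Some T'" "length C = length S"
  shows "colour_run C l = colour_run C r"
  using assms(1)
proof cases
  case (R1_right c i x d)
  then have "i < length C" using assms by (auto simp: bind_eq_Some_conv split: if_splits)
  then obtain A a B where C: "C = A @ a # B" "i = length A" by (rule split_at_1)
  obtain p q where "a = (p, q)" by (cases a)
  \<comment> \<open>Of the four colours of the minimum exactly one passes the maximum, and it
    returns the incoming colour.\<close>
  then show ?thesis using R1_right C
    by (cases p; cases q) (simp_all add: UNIV_colour colour_simps cross_colours_classical)
next
  case (R1_left c i x d)
  then have "i < length C" using assms by (auto simp: bind_eq_Some_conv split: if_splits)
  then obtain A a B where C: "C = A @ a # B" "i = length A" by (rule split_at_1)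
  obtain p q where "a = (p, q)" by (cases a)
  then show ?thesis using R1_left C
    by (cases p; cases q) (simp_all add: UNIV_colour colour_simps cross_colours_classical)
next
  case (R2 c i)
  then have "i + 1 < length C" using assms by (auto simp: bind_eq_Some_conv split: if_splits)
  then obtain A a b B where "C = A @ a # b # B" "i = length A" by (rule split_at_pair)
  then show ?thesis using R2 classical_cases[of c]
    by (cases a; cases b) (auto simp: colour_simps)
next
  case (R3 a b c i)
  then have "i + 2 < length C" using assms by (auto simp: bind_eq_Some_conv split: if_splits)
  then obtain A x y z B where "C = A @ x # y # z # B" "i = length A" by (rule split_at_3)
  then show ?thesis using R3
    by (cases x; cases y; cases z) (simp add: colour_simps cross_colours_classical)
next
  case (V1_right i x d)
  then have "i < length C" using assms by (auto simp: bind_eq_Some_conv split: if_splits)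
  then obtain A a B where "C = A @ a # B" "i = length A" by (rule split_at_1)
  then show ?thesis using V1_right by (cases a) (auto simp: colour_simps)
next
  case (V1_left i x d)
  then have "i < length C" using assms by (auto simp: bind_eq_Some_conv split: if_splits)
  then obtain A a B where "C = A @ a # B" "i = length A" by (rule split_at_1)
  then show ?thesis using V1_left by (cases a) (auto simp: colour_simps)
next
  case (V2 i)
  then have "i + 1 < length C" using assms by (auto simp: bind_eq_Some_conv split: if_splits)
  then obtain A a b B where "C = A @ a # b # B" "i = length A" by (rule split_at_pair)
  then show ?thesis using V2 by (auto simp: colour_simps)
next
  case (V3 i)
  then have "i + 2 < length C" using assms by (auto simp: bind_eq_Some_conv split: if_splits)
  then obtain A x y z B where "C = A @ x # y # z # B" "i = length A" by (rule split_at_3)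
  then show ?thesis using V3 by (simp add: colour_simps)
next
  case (V4_first c i)
  then have "i + 2 < length C" using assms by (auto simp: bind_eq_Some_conv split: if_splits)
  then obtain A x y z B where "C = A @ x # y # z # B" "i = length A" by (rule split_at_3)
  then show ?thesis using V4_first by (simp add: colour_simps cross_colours_classical)
next
  case (V4_second c i)
  then have "i + 2 < length C" using assms by (auto simp: bind_eq_Some_conv split: if_splits)
  then obtain A x y z B where "C = A @ x # y # z # B" "i = length A" by (rule split_at_3)
  then show ?thesis using V4_second by (simp add: colour_simps cross_colours_classical)
next
  case (V4_third c i)
  then have "i + 2 < length C" using assms by (auto simp: bind_eq_Some_conv split: if_splits)
  then obtain A x y z B where "C = A @ x # y # z # B" "i = length A" by (rule split_at_3)
  then show ?thesis using V4_third by (simp add: colour_simps cross_colours_classical)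
qed

lemma colour_bar_move:
  assumes "bar_move l r" "run S l = Some T" "run S r = Some T'" "length C = length S"
  shows "colour_run C l = colour_run C r"
  using assms(1)
proof cases
  case (T1_SW i)
  then have "i + 1 < length C" using assms by (auto simp: bind_eq_Some_conv split: if_splits)
  then obtain A a b B where "C = A @ a # b # B" "i = length A" by (rule split_at_pair)
  then show ?thesis using T1_SW by (simp add: colour_simps list_update_append)
next
  case (T1_SE i)
  then have "i + 1 < length C" using assms by (auto simp: bind_eq_Some_conv split: if_splits)
  then obtain A a b B where "C = A @ a # b # B" "i = length A" by (rule split_at_pair)
  then show ?thesis using T1_SE by (simp add: colour_simps list_update_append)
next
  case (T2 i)
  then have "i < length C" using assms by (auto simp: bind_eq_Some_conv split: if_splits)
  then obtain A a B where "C = A @ a # B" "i = length A" by (rule split_at_1)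
  then show ?thesis using T2 by (cases a) (simp add: colour_simps)
next
  case (T3 c i)
  then have "i + 1 < length C" using assms by (auto simp: bind_eq_Some_conv split: if_splits)
  then obtain A a b B where C: "C = A @ a # b # B" "i = length A" by (rule split_at_pair)
  \<comment> \<open>Adding \<open>(1, 1)\<close> to both incoming colours of the crossing adds it to
    both outgoing ones, so the constants of the four bars cancel. What remains is the compatibility
    of the linear rule with the exchange of coordinates.\<close>
  obtain p q r s where "a = (p, q)" "b = (r, s)" by (cases a; cases b)
  then show ?thesis using T3 C
    by (cases p; cases q; cases r; cases s)
      (simp_all add: colour_simps cross_colours_classical list_update_append)
qed

abbreviation twisted_move :: "'l word \<Rightarrow> 'l word \<Rightarrow> bool" where
  "twisted_move l r \<equiv> isotopy_move l r \<or> generalized_move l r \<or> bar_move l r"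

lemma twisted_stepE:
  assumes "twisted_step D E"
  obtains u l r v S T T' where "D = u @ l @ v" "E = u @ r @ v" "twisted_move l r"
    "run [] u = Some S" "run S l = Some T" "run S r = Some T'"
proof -
  from assms have lc: "local_change twisted_move D E"
    and run: "run [] D = Some []" "run [] E = Some []"
    by (auto simp: twisted_step_def twisted_diagram_def)
  from lc obtain u l r v where *: "D = u @ l @ v" "E = u @ r @ v" "twisted_move l r"
    by (cases rule: local_change.cases) auto
  then show thesis using run that by (auto simp: run_append bind_eq_Some_conv)
qed

lemma twisted_equivalent_invariant:
  assumes "\<And>D E. twisted_step D E \<Longrightarrow> f D = f E" "twisted_equivalent D E"
  shows "f D = f E"
proof -
  have "equivclp twisted_step D E" using assms(2) by (simp add: twisted_equivalent_def)
  then show ?thesis by (induction rule: equivclp_induct) (use assms(1) in auto)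
qed

lemma colourable_invariant:
  assumes "twisted_equivalent D E" shows "colourable D = colourable E"
proof (rule twisted_equivalent_invariant[OF _ assms])
  fix D E :: "'a word" assume "twisted_step D E"
  then obtain u l r v S T T' where *: "D = u @ l @ v" "E = u @ r @ v" "twisted_move l r"
    "run [] u = Some S" "run S l = Some T" "run S r = Some T'"
    by (rule twisted_stepE)
  have "colour_run C l = colour_run C r" if "C \<in> colour_run [] u" for C
    using *(3) colour_run_length[OF *(4) _ that] colour_isotopy_move[OF _ *(5,6), of C]
      colour_generalized_move[OF _ *(5,6), of C] colour_bar_move[OF _ *(5,6), of C] by auto
  then show "colourable D = colourable E"
    by (simp add: colourable_def *(1,2) colour_run_append)
qed

section \<open>Invariance of the set of labels\<close>

definition labels :: "'l word \<Rightarrow> 'l set" where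
  "labels D = {x. \<exists>i d. (i, Cup x d) \<in> set D}"

lemma labels_simps [simp]:
  "labels [] = {}" "labels ((i, Cup x d) # w) = insert x (labels w)"
  "labels ((i, Cap) # w) = labels w" "labels ((i, Cross c) # w) = labels w"
  "labels ((i, Bar) # w) = labels w" "labels (v @ w) = labels v \<union> labels w"
  by (auto simp: labels_def)

lemma labels_pass: "pass S (i, p) = Some T \<Longrightarrow> fst ` set T \<subseteq> fst ` set S \<union> labels [(i, p)]"
proof (cases p)
  case (Cross c)
  assume *: "pass S (i, p) = Some T"
  then have "i + 1 < length S" using Cross by (simp split: if_splits)
  then show ?thesis using * Cross by (elim split_at_pair) (auto simp: nth_append)
qed (auto split: if_splits dest!: in_set_takeD in_set_dropD)

lemma labels_run: "run S w = Some T \<Longrightarrow> fst ` set T \<subseteq> fst ` set S \<union> labels w"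
proof (induction w arbitrary: S)
  case (Cons e w)
  obtain i p where e: "e = (i, p)" by (cases e)
  obtain M where M: "pass S (i, p) = Some M" "run M w = Some T"
    using Cons.prems(1) e by (auto simp: bind_eq_Some_conv)
  have "labels (e # w) = labels [(i, p)] \<union> labels w" by (auto simp: e labels_def)
  then show ?case using Cons.IH[OF M(2)] labels_pass[OF M(1)] by blast
qed simp

text \<open>The maximum in such a move joins the created or cancelled minimum to an incoming strand,
  whose label it therefore shares. So no label appears or disappears.\<close>

lemma labels_move:
  assumes "twisted_move l r" "run S l = Some T"
  shows "fst ` set S \<union> labels l = fst ` set S \<union> labels r"
proof -
  have mem: "x \<in> fst ` set S" if "i < length S" "fst (S ! i) = x" for i x
    using that by (metis image_eqI nth_mem)
  have right: "x \<in> fst ` set S" if "run S ((i + 1, Cup x d) # w) = Some T"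
    "w = [(i, Cap)] \<or> w = [(i, Cross c), (i + 1, Cap)]" for i x d w c
    using that by (intro mem[of i]) (auto simp: nth_append min_def split: if_splits)
  have left: "x \<in> fst ` set S" if "run S ((i, Cup x d) # w) = Some T"
    "w = [(i + 1, Cap)] \<or> w = [(i + 1, Cross c), (i, Cap)]" for i x d w c
    using that by (intro mem[of i]) (auto simp: nth_append min_def split: if_splits)
  from assms(1) consider "isotopy_move l r" | "generalized_move l r" | "bar_move l r" by blast
  then show ?thesis
  proof cases
    case 1
    then show ?thesis
    proof cases
      case (exchange i j p q)
      then show ?thesis by (auto simp: labels_def)
    next
      case (cancel_right i x d)
      then show ?thesis using right[of i x d "[(i, Cap)]"] assms(2) by (simp only: labels_simps insert_absorb) auto
    next
      case (cancel_left i x d)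
      then show ?thesis using left[of i x d "[(i + 1, Cap)]"] assms(2) by (simp only: labels_simps insert_absorb) auto
    qed simp_all
  next
    case 2
    then show ?thesis
    proof cases
      case (R1_right c i x d)
      then show ?thesis using right[of i x d "[(i, Cross c), (i + 1, Cap)]" c] assms(2)
        by (simp only: labels_simps insert_absorb) auto
    next
      case (R1_left c i x d)
      then show ?thesis using left[of i x d "[(i + 1, Cross c), (i, Cap)]" c] assms(2)
        by (simp only: labels_simps insert_absorb) auto
    next
      case (V1_right i x d)
      then show ?thesis using right[of i x d "[(i, Cross Virtual), (i + 1, Cap)]" Virtual] assms(2)
        by (simp only: labels_simps insert_absorb) auto
    next
      case (V1_left i x d)
      then show ?thesis using left[of i x d "[(i + 1, Cross Virtual), (i, Cap)]" Virtual] assms(2)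
        by (simp only: labels_simps insert_absorb) auto
    qed simp_all
  next
    case 3
    then show ?thesis by cases simp_all
  qed
qed

text \<open>Labels number the components of an ordered diagram, so this invariant counts them. The
  strands that enter the move carry labels of minima in \<open>u\<close>, by
  \<open>labels_run\<close>.\<close>

lemma labels_invariant:
  assumes "twisted_equivalent D E" shows "labels D = labels E"
proof (rule twisted_equivalent_invariant[OF _ assms])
  fix D E :: "'a word" assume "twisted_step D E"
  then obtain u l r v S T T' where *: "D = u @ l @ v" "E = u @ r @ v" "twisted_move l r"
    "run [] u = Some S" "run S l = Some T" "run S r = Some T'"
    by (rule twisted_stepE)
  show "labels D = labels E"
    using labels_move[OF *(3,5)] labels_run[OF *(4)] by (auto simp: *(1,2))
qed

section \<open>Colourings of the two knots\<close>

lemma colour_run_appendI: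
  "D \<in> colour_run C u \<Longrightarrow> E \<in> colour_run D v \<Longrightarrow> E \<in> colour_run C (u @ v)"
  by (auto simp: colour_run_append)

lemma colour_run_cups:
  "C \<in> colour_run [] (cups x) \<longleftrightarrow> (\<exists>a b. C = [a, prod.swap a, b, prod.swap b])"
  by (simp add: cups_def numeral_eq_Suc del: split_paired_Ex)

lemma colour_run_bars: "colour_run [a, b, c, d] bars = {[bar_colour a, b, bar_colour c, d]}"
  by (simp add: bars_def numeral_eq_Suc)

text \<open>If the minimum in the curl is coloured \<open>(\<alpha>, \<beta>)\<close>, the two
  equations at its maximum reduce to \<open>s = q\<close> and
  \<open>\<alpha> + \<beta> = p + r\<close>. With the remaining free parameter
  \<open>\<gamma> = p + q + \<alpha>\<close>, the outgoing colours are \<open>(\<gamma>, r)\<close>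
  and \<open>(p, \<gamma>)\<close>.\<close>

lemma colour_run_curlD:
  "D \<in> colour_run [a, b, (p, q), (r, s)] (shift 2 (curl x)) \<Longrightarrow> s = q"
  by (auto simp: curl_def numeral_eq_Suc add.assoc add.commute add.left_commute split: if_splits)

lemma not_colourable_core_y: "colour_run [] (core_y x) = {}"
proof -
  have "colour_run C (bars @ curls x @ w) = {}" if cups: "C \<in> colour_run [] (cups x)" for C w
  proof -
    obtain a b where C: "C = [a, prod.swap a, b, prod.swap b]"
      using cups unfolding colour_run_cups by blast
    obtain p q where "b = (p, q)" by (cases b)
    with C have "C = [a, prod.swap a, (p, q), (q, p)]" by simp
    \<comment> \<open>Behind the bar the right minimum sends \<open>(q + 1, p + 1)\<close> and
      \<open>(q, p)\<close> into the right curl, with different second coordinates.\<close>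
    moreover have "q + 1 \<noteq> q" "p + 1 \<noteq> p" by (cases q; cases p; simp)+
    ultimately show ?thesis
      using colour_run_curlD[of _ "bar_colour a" "prod.swap a" "q + 1" "p + 1" q p x]
      by (auto simp: colour_run_append colour_run_bars curls_def)
  qed
  then show ?thesis by (simp add: core_y_def colour_run_append[of "[]" "cups x"])
qed

lemma colourable_core_x: "[] \<in> colour_run [] (core_x x)"
  unfolding core_x_def curls_def append_assoc
proof (intro colour_run_appendI)
  \<comment> \<open>The twist leads branches of both minima into each curl. Since
    \<open>bar_colour\<close> exchanges \<open>(0, 0)\<close> and \<open>(1, 1)\<close>, each curl
    receives two equal colours.\<close>
  show "[(0, 0), (0, 0), (1, 1), (1, 1)] \<in> colour_run [] (cups x)"
    unfolding colour_run_cups by auto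
  show "[(0, 0), (1, 1), (1, 1), (0, 0)] \<in> colour_run [(0, 0), (0, 0), (1, 1), (1, 1)] (swap_word [1, 2, 1])"
    by (simp add: numeral_eq_Suc)
  show "[(1, 1), (1, 1), (0, 0), (0, 0)] \<in> colour_run [(0, 0), (1, 1), (1, 1), (0, 0)] bars"
    by (simp add: colour_run_bars)
  \<comment> \<open>The free parameter is 1 in the right curl and 0 in the left one. This yields the
    colours \<open>(1, 0)\<close> and \<open>(0, 1)\<close>, which \<open>bar_colour\<close> fixes
    and which match at the maxima.\<close>
  show "[(1, 1), (1, 1), (1, 0), (0, 1)] \<in> colour_run [(1, 1), (1, 1), (0, 0), (0, 0)] (shift 2 (curl x))"
    by (simp add: curl_def numeral_eq_Suc UNIV_colour)
  show "[(0, 1), (1, 0), (1, 0), (0, 1)] \<in> colour_run [(1, 1), (1, 1), (1, 0), (0, 1)] (curl x)"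
    by (simp add: curl_def numeral_eq_Suc UNIV_colour)
  show "[(0, 1), (1, 0), (1, 0), (0, 1)] \<in> colour_run [(0, 1), (1, 0), (1, 0), (0, 1)] bars"
    by (simp add: colour_run_bars)
  show "[] \<in> colour_run [(0, 1), (1, 0), (1, 0), (0, 1)] caps"
    by (simp add: caps_def)
qed

section \<open>The infinite family\<close>

definition circles :: "'l list \<Rightarrow> 'l word" where
  "circles xs = concat (map (\<lambda>x. [(0, Cup x True), (0, Cap)]) xs)"

lemma circles_simps [simp]:
  "circles [] = []" "circles (x # xs) = [(0, Cup x True), (0, Cap)] @ circles xs"
  by (simp_all add: circles_def)

lemma run_circles: "run [] (circles xs) = Some []"
  by (induction xs) auto

lemma colour_run_circles: "[] \<in> colour_run [] (circles xs)"
  by (induction xs) auto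

lemma labels_circles: "labels (circles xs) = set xs"
  by (induction xs) auto

lemma labels_core: "labels (core_x x) = {x}" "labels (core_y x) = {x}"
  by (simp_all add: core_x_def core_y_def cups_def bars_def caps_def curls_def curl_def)

text \<open>Circles preserve the distinction: each of them can be coloured, and nothing placed above
  \<open>core_y\<close> revives an empty set of colourings.\<close>

lemma not_twisted_equivalent:
  "\<not> twisted_equivalent (core_x x @ circles xs) (core_y x @ circles xs)"
  using colourable_invariant[of "core_x x @ circles xs" "core_y x @ circles xs"]
    colourable_core_x[of x] not_colourable_core_y[of x] colour_run_circles[of xs]
  by (auto simp: colourable_def colour_run_append)

lemma cover_from_no_Bar: "Bar \<notin> snd ` set (cover_from n w)"
proof (induction n w rule: cover_from.induct)
  case (2 n i p w)
  have "Bar \<notin> snd ` set (level_cover n (i, p))"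
    by (cases p) (auto simp: bar_cover_def Let_def)
  then show ?case using 2 by auto
qed simp

lemma run_double_cover_core: "run [] (double_cover (core_x x)) = Some []"
  by (simp only: double_cover_core run_append run_cover_swaps run_cover_curls bind.bind_lunit)

lemma run_cover_circles: "run [] (cover_from 0 (circles xs)) = Some []"
  by (induction xs) (simp_all add: numeral_eq_Suc)

lemma virtual_equivalent_covers:
  "virtual_equivalent (double_cover (core_x x @ circles xs)) (double_cover (core_y x @ circles xs))"
proof -
  have cover: "double_cover (core_x x @ circles xs) = double_cover (core_x x) @ cover_from 0 (circles xs)"
    "double_cover (core_y x @ circles xs) = double_cover (core_y x) @ cover_from 0 (circles xs)"
    using cover_from_append[OF run_core(1)[of x], of "circles xs"]
      cover_from_append[OF run_core(2)[of x], of "circles xs"]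
    by (simp_all add: double_cover_def)
  have "tangle_eq [] (double_cover (core_x x @ circles xs)) (double_cover (core_y x @ circles xs))"
    unfolding cover by (intro tangle_eq_append_left double_covers_tangle_eq)
  moreover have "virtual_diagram (double_cover (core_x x @ circles xs))"
    unfolding virtual_diagram_def twisted_diagram_def
  proof
    show "run [] (double_cover (core_x x @ circles xs)) = Some []"
      unfolding cover by (simp only: run_append run_double_cover_core run_cover_circles bind.bind_lunit)
    show "Bar \<notin> snd ` set (double_cover (core_x x @ circles xs))"
      unfolding double_cover_def by (rule cover_from_no_Bar)
  qed
  ultimately show ?thesis by (rule virtual_equivalentI)
qed

section \<open>Diagrams without labels\<close>

lemma forget_labels_simps [simp]:
  "forget_labels [] = []" "forget_labels (v @ w) = forget_labels v @ forget_labels w"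
  "forget_labels ((i, p) # w) = (i, map_piece (\<lambda>_. ()) p) # forget_labels w"
  by (simp_all add: forget_labels_def)

text \<open>The constructions are polymorphic in the labels. Forgetting labels gives their instances
  at type \<open>unit\<close>, so the unordered and unpartitioned claims are instances of the
  labelled ones.\<close>

lemma forget_labels_diagrams:
  "forget_labels (core_x x @ circles xs) = core_x () @ circles (map (\<lambda>_. ()) xs)"
  "forget_labels (core_y x @ circles xs) = core_y () @ circles (map (\<lambda>_. ()) xs)"
proof -
  have "forget_labels (circles xs) = circles (map (\<lambda>_. ()) xs)"
    by (induction xs) simp_all
  then show "forget_labels (core_x x @ circles xs) = core_x () @ circles (map (\<lambda>_. ()) xs)"
    "forget_labels (core_y x @ circles xs) = core_y () @ circles (map (\<lambda>_. ()) xs)"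
    by (simp_all add: core_x_def core_y_def cups_def bars_def curls_def curl_def caps_def)
qed

lemma forget_labels_cover_from: "forget_labels (cover_from n w) = cover_from n (forget_labels w)"
proof (induction n w rule: cover_from.induct)
  case (2 n i p w)
  have "forget_labels (level_cover n (i, p)) = level_cover n (i, map_piece (\<lambda>_. ()) p)"
    by (cases p) (simp_all add: bar_cover_def Let_def forget_labels_def)
  moreover have "ends_below (map_piece (\<lambda>_. ()) p) = ends_below p"
    "ends_above (map_piece (\<lambda>_. ()) p) = ends_above p"
    by (cases p; simp)+
  ultimately show ?case using 2 by simp
qed simp

lemma forget_labels_double_cover: "forget_labels (double_cover D) = double_cover (forget_labels D)"
  unfolding double_cover_def by (rule forget_labels_cover_from)

section \<open>Components\<close>

text \<open>Together with \<open>follow\<close> this traces stretches of a curve by evaluation;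
  \<open>None\<close> marks a strand that ends in a maximum.\<close>

fun strand_up :: "nat \<times> 'l piece \<Rightarrow> nat \<Rightarrow> nat option" where
  "strand_up (i, p) q =
     (if q < i then Some q
      else if i + ends_below p \<le> q then Some (q - ends_below p + ends_above p)
      else case p of Cross c \<Rightarrow> Some (if q = i then i + 1 else i) | Bar \<Rightarrow> Some q | _ \<Rightarrow> None)"

fun follow :: "'l word \<Rightarrow> nat \<Rightarrow> nat option" where
  "follow [] q = Some q"
| "follow (e # w) q = Option.bind (strand_up e q) (follow w)"

lemma same_component_refl [simp]: "same_component D P P"
  by (simp add: same_component_def)

lemma same_component_sym: "same_component D P Q \<Longrightarrow> same_component D Q P"
  by (auto simp: same_component_def intro: equivclp_sym)

lemma same_component_trans [trans]:
  "same_component D P Q \<Longrightarrow> same_component D Q R \<Longrightarrow> same_component D P R"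
  unfolding same_component_def by (rule equivclp_trans)

lemma adjacent_same_component: "adjacent D P Q \<Longrightarrow> same_component D P Q"
  by (auto simp: same_component_def)

lemma strand_up_same_component:
  assumes "t < length D" "strand_up (D ! t) q = Some q'"
  shows "same_component D (t, q) (t + 1, q')"
proof -
  obtain i p where e: "D ! t = (i, p)" by (cases "D ! t")
  consider "q < i" | "i + ends_below p \<le> q" | c where "p = Cross c" "q = i" | c where "p = Cross c" "q = i + 1"
    | "p = Bar" "q = i"
    using assms(2) e by (cases p) (auto split: if_splits)
  then have "adjacent D (t, q) (t + 1, q')"
  proof cases
    case 1
    then show ?thesis using assms e adjacent.left by auto
  next
    case 2
    then show ?thesis
      using assms e adjacent.right[OF assms(1) e, of "q - ends_below p"] by simp
  qed (use assms e adjacent.cross_SW adjacent.cross_SE adjacent.bar in auto)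
  then show ?thesis by (rule adjacent_same_component)
qed

lemma follow_same_component:
  "t + length w \<le> length D \<Longrightarrow> take (length w) (drop t D) = w \<Longrightarrow> follow w q = Some q' \<Longrightarrow>
    same_component D (t, q) (t + length w, q')"
proof (induction w arbitrary: t q)
  case (Cons e w)
  have t: "t < length D" using Cons.prems(1) by simp
  have D: "drop t D = D ! t # drop (t + 1) D" using t by (simp add: Cons_nth_drop_Suc)
  then have e: "D ! t = e" "take (length w) (drop (t + 1) D) = w" using Cons.prems(2) by auto
  obtain r where r: "strand_up e q = Some r" "follow w r = Some q'"
    using Cons.prems(3) by (auto simp: bind_eq_Some_conv)
  have "same_component D (t, q) (t + 1, r)"
    using strand_up_same_component[OF t] e r by simp
  also have "same_component D (t + 1, r) (t + 1 + length w, q')"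
    using Cons.IH[OF _ e(2) r(2)] Cons.prems(1) by simp
  finally show ?case by simp
qed simp

lemma follow_component:
  assumes "follow (take k (drop t D)) q = Some q'" "t + k \<le> length D" "t' = t + k"
  shows "same_component D (t, q) (t', q')"
proof -
  have "length (take k (drop t D)) = k" using assms(2) by simp
  then show ?thesis
    using follow_same_component[of t "take k (drop t D)" D q q'] assms by simp
qed

lemma same_component_append: "same_component D P Q \<Longrightarrow> same_component (D @ E) P Q"
proof -
  have "adjacent D P Q \<Longrightarrow> adjacent (D @ E) P Q" for P Q
  proof (induction rule: adjacent.induct)
    case (left t i p q)
    then show ?case using adjacent.left[of t "D @ E" i p q] by (simp add: nth_append)
  next
    case (right t i p q)
    then show ?case using adjacent.right[of t "D @ E" i p q] by (simp add: nth_append)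
  next
    case (cup t i x d)
    then show ?case using adjacent.cup[of t "D @ E" i x d] by (simp add: nth_append)
  next
    case (cap t i)
    then show ?case using adjacent.cap[of t "D @ E" i] by (simp add: nth_append)
  next
    case (cross_SW t i c)
    then show ?case using adjacent.cross_SW[of t "D @ E" i c] by (simp add: nth_append)
  next
    case (cross_SE t i c)
    then show ?case using adjacent.cross_SE[of t "D @ E" i c] by (simp add: nth_append)
  next
    case (bar t i)
    then show ?case using adjacent.bar[of t "D @ E" i] by (simp add: nth_append)
  qed
  then have *: "adjacent D P Q \<Longrightarrow> same_component (D @ E) P Q" for P Q
    by (rule adjacent_same_component)
  assume "same_component D P Q"
  then show ?thesis
    unfolding same_component_def[of D]
    by (induction rule: equivclp_induct) (auto dest!: * intro: same_component_sym same_component_trans)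
qed

lemma strands_at_Suc:
  assumes "run [] D = Some T" "t < length D"
  shows "pass (strands_at D t) (D ! t) = Some (strands_at D (t + 1))"
proof -
  have "D = take t D @ D ! t # drop (t + 1) D" using assms(2) by (simp add: id_take_nth_drop)
  then have "run [] (take t D @ D ! t # drop (t + 1) D) = Some T" using assms(1) by simp
  then obtain S S' where "run [] (take t D) = Some S" "pass S (D ! t) = Some S'"
    by (auto simp: run_append bind_eq_Some_conv)
  moreover then have "run [] (take (t + 1) D) = Some S'"
    using assms(2) by (simp add: take_Suc_conv_app_nth run_append)
  ultimately show ?thesis by (simp add: strands_at_def)
qed

text \<open>Descending along a strand from any point ends at a minimum. Questions about labels and
  components thereby reduce to finitely many minima.\<close>

lemma reach_cup:
  assumes "run [] D = Some T" "t \<le> length D" "q < length (strands_at D t)"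
  shows "\<exists>s i x d. s < length D \<and> D ! s = (i, Cup x d) \<and> same_component D (s + 1, i) (t, q) \<and>
    label_at D (t, q) = x"
  using assms(2,3)
proof (induction t arbitrary: q)
  case 0
  then show ?case by (simp add: strands_at_def)
next
  case (Suc t)
  obtain i p where e: "D ! t = (i, p)" by (cases "D ! t")
  have t: "t < length D" using Suc.prems by simp
  obtain A L L' B where *: "strands_at D t = A @ L @ B" "length A = i" "length L = ends_below p"
    "pass L (0, p) = Some L'" "length L' = ends_above p" "strands_at D (t + 1) = A @ L' @ B"
    using strands_at_Suc[OF assms(1) t] unfolding e by (rule pass_split)
  have step: ?case if "same_component D (t, r) (Suc t, q)" "r < length (strands_at D t)"
    "label_at D (t, r) = label_at D (Suc t, q)" for r
    using Suc.IH[of r] t that by (auto intro: same_component_trans)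
  consider "q < i" | r where "q = i + ends_above p + r" | "i \<le> q" "q < i + ends_above p"
    by (metis le_iff_add not_less)
  then show ?case
  proof cases
    case 1
    then have "adjacent D (t, q) (t + 1, q)" using e t by (intro adjacent.left)
    then show ?thesis using * 1
      by (intro step[of q] adjacent_same_component) (auto simp: label_at_def nth_append)
  next
    case 2
    then have "adjacent D (t, i + r + ends_below p) (t + 1, i + r + ends_above p)"
      using e t by (intro adjacent.right) auto
    then show ?thesis using * 2 Suc.prems
      by (intro step[of "i + ends_below p + r"] adjacent_same_component)
        (auto simp: label_at_def nth_append ac_simps)
  next
    case 3
    show ?thesis
    proof (cases p)
      case (Cup x d)
      then have L: "L = []" "L' = [(x, d), (x, \<not> d)]" using *(3,4) by auto
      have "adjacent D (t + 1, i) (t + 1, i + 1)" using e t Cup by (intro adjacent.cup) auto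
      moreover have "q = i \<or> q = i + 1" using 3 Cup by auto
      moreover from this have "label_at D (Suc t, q) = x"
        using * L by (auto simp: label_at_def nth_append)
      ultimately show ?thesis
        using e t Cup
        by (intro exI[of _ t] exI[of _ i] exI[of _ x] exI[of _ d]) (auto intro: adjacent_same_component)
    next
      case (Cross c)
      then obtain u v where L: "L = [u, v]" "L' = [v, u]"
        using *(3,4) by (auto simp: length_Suc_conv numeral_2_eq_2)
      have "q = i \<or> q = i + 1" using 3 Cross by auto
      then show ?thesis
      proof
        assume q: "q = i"
        have "adjacent D (t, i + 1) (t + 1, i)" using e t Cross by (intro adjacent.cross_SE) auto
        then show ?thesis using * L q
          by (intro step[of "i + 1"] adjacent_same_component) (auto simp: label_at_def nth_append)
      next
        assume q: "q = i + 1"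
        have "adjacent D (t, i) (t + 1, i + 1)" using e t Cross by (intro adjacent.cross_SW) auto
        then show ?thesis using * L q
          by (intro step[of i] adjacent_same_component) (auto simp: label_at_def nth_append)
      qed
    next
      case Bar
      then obtain u where L: "L = [u]" "L' = [u]"
        using *(3,4) by (auto simp: length_Suc_conv)
      have q: "q = i" using 3 Bar by auto
      have "adjacent D (t, i) (t + 1, i)" using e t Bar by (intro adjacent.bar) auto
      then show ?thesis using *(1,2,6) L q
        by (intro step[of i] adjacent_same_component) (auto simp: label_at_def nth_append)
    qed (use 3 in simp)
  qed
qed

lemma labels_eq_label_at:
  assumes "run [] D = Some T"
  shows "label_at D ` points D = labels D"
proof
  show "label_at D ` points D \<subseteq> labels D"
  proof
    fix x assume "x \<in> label_at D ` points D"
    then obtain t q where "t \<le> length D" "q < length (strands_at D t)" "x = label_at D (t, q)"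
      by (auto simp: points_def)
    then obtain s i d where "s < length D" "D ! s = (i, Cup x d)"
      using reach_cup[OF assms, of t q] by blast
    then show "x \<in> labels D" using nth_mem[of s D] by (auto simp: labels_def)
  qed
  show "labels D \<subseteq> label_at D ` points D"
  proof
    fix x assume "x \<in> labels D"
    then obtain t i d where t: "t < length D" "D ! t = (i, Cup x d)"
      unfolding labels_def by (auto simp: in_set_conv_nth)
    then have "pass (strands_at D t) (i, Cup x d) = Some (strands_at D (t + 1))"
      using strands_at_Suc[OF assms t(1)] by simp
    then have "i \<le> length (strands_at D t)"
      "strands_at D (t + 1) = take i (strands_at D t) @ [(x, d), (x, \<not> d)] @ drop i (strands_at D t)"
      by (auto split: if_splits)
    then have "i < length (strands_at D (t + 1))" "label_at D (t + 1, i) = x"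
      by (simp_all add: label_at_def nth_append)
    then show "x \<in> label_at D ` points D" using t(1)
      by (intro image_eqI[of _ _ "(t + 1, i)"]) (auto simp: points_def)
  qed
qed

lemma ordered_twisted_diagramI:
  assumes "twisted_diagram D" "labels D = {1..m}"
    and "\<And>s t i j x d e. s < length D \<Longrightarrow> t < length D \<Longrightarrow> D ! s = (i, Cup x d) \<Longrightarrow>
      D ! t = (j, Cup x e) \<Longrightarrow> same_component D (s + 1, i) (t + 1, j)"
  shows "ordered_twisted_diagram D"
proof -
  have run: "run [] D = Some []" using assms(1) by (simp add: twisted_diagram_def)
  have "same_component D P Q" if "P \<in> points D" "Q \<in> points D" "label_at D P = label_at D Q" for P Q
  proof -
    obtain t q u r where PQ: "P = (t, q)" "Q = (u, r)" by (cases P; cases Q)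
    have "t \<le> length D" "q < length (strands_at D t)" "u \<le> length D" "r < length (strands_at D u)"
      using that(1,2) by (auto simp: PQ points_def)
    then obtain s i x d s' i' x' d' where s: "s < length D" "D ! s = (i, Cup x d)"
        "same_component D (s + 1, i) P" "label_at D P = x"
      and s': "s' < length D" "D ! s' = (i', Cup x' d')"
        "same_component D (s' + 1, i') Q" "label_at D Q = x'"
      using reach_cup[OF run] unfolding PQ by metis
    have "same_component D (s + 1, i) (s' + 1, i')"
      using assms(3) s s' that(3) by metis
    then show ?thesis using s(3) s'(3) same_component_sym same_component_trans by metis
  qed
  then show ?thesis
    using assms(1,2) labels_eq_label_at[OF run] unfolding ordered_twisted_diagram_def by auto
qed

section \<open>Components of the diagrams in the family\<close>

lemma word_defs:
  "core_x x = [(0, Cup x False), (2, Cup x False), (1, Cross Virtual), (2, Cross Virtual), (1, Cross Virtual),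
    (0, Bar), (2, Bar), (3, Cup x False), (4, Cross Over), (4, Cross Virtual), (2, Cross Over), (3, Cap),
    (1, Cup x False), (2, Cross Over), (2, Cross Virtual), (0, Cross Over), (1, Cap), (0, Bar), (2, Bar),
    (0, Cap), (0, Cap)]"
  "core_y x = [(0, Cup x False), (2, Cup x False), (0, Bar), (2, Bar),
    (3, Cup x False), (4, Cross Over), (4, Cross Virtual), (2, Cross Over), (3, Cap),
    (1, Cup x False), (2, Cross Over), (2, Cross Virtual), (0, Cross Over), (1, Cap), (0, Bar), (2, Bar),
    (1, Cross Virtual), (2, Cross Virtual), (1, Cross Virtual), (0, Cap), (0, Cap)]"
  by (simp_all add: core_x_def core_y_def cups_def bars_def caps_def curls_def curl_def)

lemma same_component_cup:
  "t < length D \<Longrightarrow> D ! t = (i, Cup x d) \<Longrightarrow> same_component D (t + 1, i) (t + 1, i + 1)"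
  by (rule adjacent_same_component[OF adjacent.cup])

lemma same_component_cap:
  "t < length D \<Longrightarrow> D ! t = (i, Cap) \<Longrightarrow> same_component D (t, i) (t, i + 1)"
  by (rule adjacent_same_component[OF adjacent.cap])

text \<open>The minima have indices 0, 1, 7 and 12 in the word; the points named lie one level
  higher, on their left branches. The curve is traced between extrema, and its downward stretches
  are followed upwards and reversed by symmetry.\<close>

lemma core_x_cups:
  "same_component (core_x x) (1, 0) (2, 2)"
  "same_component (core_x x) (1, 0) (8, 3)"
  "same_component (core_x x) (1, 0) (13, 1)"
proof -
  let ?D = "core_x x"
  note words = word_defs numeral_eq_Suc
  have "same_component ?D (1, 0) (16, 1)" by (rule follow_component[where k = 15]) (simp_all add: words)
  also have "same_component ?D (16, 1) (16, 2)" using same_component_cap[of 16 ?D 1] by (simp add: words)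
  also have "same_component ?D (16, 2) (13, 2)"
    by (rule same_component_sym, rule follow_component[where k = 3]) (simp_all add: words)
  also have "same_component ?D (13, 2) (13, 1)"
    by (rule same_component_sym, use same_component_cup[of 12 ?D 1 x False] in \<open>simp add: words\<close>)
  finally show 3: "same_component ?D (1, 0) (13, 1)" .
  also have "same_component ?D (13, 1) (19, 0)" by (rule follow_component[where k = 6]) (simp_all add: words)
  also have "same_component ?D (19, 0) (19, 1)" using same_component_cap[of 19 ?D 0] by (simp add: words)
  also have "same_component ?D (19, 1) (2, 3)"
    by (rule same_component_sym, rule follow_component[where k = 17]) (simp_all add: words)
  also have "same_component ?D (2, 3) (2, 2)"
    by (rule same_component_sym, use same_component_cup[of 1 ?D 2 x False] in \<open>simp add: words\<close>)
  finally show 1: "same_component ?D (1, 0) (2, 2)" .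
  also have "same_component ?D (2, 2) (11, 3)" by (rule follow_component[where k = 9]) (simp_all add: words)
  also have "same_component ?D (11, 3) (11, 4)" using same_component_cap[of 11 ?D 3] by (simp add: words)
  also have "same_component ?D (11, 4) (8, 4)"
    by (rule same_component_sym, rule follow_component[where k = 3]) (simp_all add: words)
  also have "same_component ?D (8, 4) (8, 3)"
    by (rule same_component_sym, use same_component_cup[of 7 ?D 3 x False] in \<open>simp add: words\<close>)
  finally show "same_component ?D (1, 0) (8, 3)" .
qed

lemma core_y_cups:
  "same_component (core_y x) (1, 0) (2, 2)"
  "same_component (core_y x) (1, 0) (5, 3)"
  "same_component (core_y x) (1, 0) (10, 1)"
proof -
  let ?D = "core_y x"
  note words = word_defs numeral_eq_Suc
  have "same_component ?D (1, 0) (13, 1)" by (rule follow_component[where k = 12]) (simp_all add: words)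
  also have "same_component ?D (13, 1) (13, 2)" using same_component_cap[of 13 ?D 1] by (simp add: words)
  also have "same_component ?D (13, 2) (10, 2)"
    by (rule same_component_sym, rule follow_component[where k = 3]) (simp_all add: words)
  also have "same_component ?D (10, 2) (10, 1)"
    by (rule same_component_sym, use same_component_cup[of 9 ?D 1 x False] in \<open>simp add: words\<close>)
  finally show 3: "same_component ?D (1, 0) (10, 1)" .
  also have "same_component ?D (10, 1) (19, 0)" by (rule follow_component[where k = 9]) (simp_all add: words)
  also have "same_component ?D (19, 0) (19, 1)" using same_component_cap[of 19 ?D 0] by (simp add: words)
  also have "same_component ?D (19, 1) (2, 3)"
    by (rule same_component_sym, rule follow_component[where k = 17]) (simp_all add: words)
  also have "same_component ?D (2, 3) (2, 2)"
    by (rule same_component_sym, use same_component_cup[of 1 ?D 2 x False] in \<open>simp add: words\<close>)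
  finally show 1: "same_component ?D (1, 0) (2, 2)" .
  also have "same_component ?D (2, 2) (8, 3)" by (rule follow_component[where k = 6]) (simp_all add: words)
  also have "same_component ?D (8, 3) (8, 4)" using same_component_cap[of 8 ?D 3] by (simp add: words)
  also have "same_component ?D (8, 4) (5, 4)"
    by (rule same_component_sym, rule follow_component[where k = 3]) (simp_all add: words)
  also have "same_component ?D (5, 4) (5, 3)"
    by (rule same_component_sym, use same_component_cup[of 4 ?D 3 x False] in \<open>simp add: words\<close>)
  finally show "same_component ?D (1, 0) (5, 3)" .
qed

lemma core_cup_component:
  "s < length (core_x x) \<Longrightarrow> core_x x ! s = (i, Cup y d) \<Longrightarrow> same_component (core_x x) (1, 0) (s + 1, i)"
  "s < length (core_y x) \<Longrightarrow> core_y x ! s = (i, Cup y d) \<Longrightarrow> same_component (core_y x) (1, 0) (s + 1, i)"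
proof -
  assume "s < length (core_x x)" "core_x x ! s = (i, Cup y d)"
  then have "(s, i) \<in> {(0, 0), (1, 2), (7, 3), (12, 1)}"
    by (auto simp: word_defs nth_Cons' split: if_splits)
  then show "same_component (core_x x) (1, 0) (s + 1, i)"
    using core_x_cups[of x] by (auto simp: numeral_2_eq_2)
next
  assume "s < length (core_y x)" "core_y x ! s = (i, Cup y d)"
  then have "(s, i) \<in> {(0, 0), (1, 2), (4, 3), (9, 1)}"
    by (auto simp: word_defs nth_Cons' split: if_splits)
  then show "same_component (core_y x) (1, 0) (s + 1, i)"
    using core_y_cups[of x] by (auto simp: numeral_2_eq_2)
qed

lemma circles_cup_unique:
  "distinct xs \<Longrightarrow> s < length (circles xs) \<Longrightarrow> t < length (circles xs) \<Longrightarrow>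
    circles xs ! s = (i, Cup x d) \<Longrightarrow> circles xs ! t = (j, Cup x e) \<Longrightarrow> s = t"
proof (induction xs arbitrary: s t)
  case (Cons y xs)
  have mem: "x \<in> set xs" if "u < length (circles xs)" "circles xs ! u = (k, Cup x f)" for u k f
  proof -
    have "(k, Cup x f) \<in> set (circles xs)" using that nth_mem by metis
    then show ?thesis using labels_circles[of xs] by (auto simp: labels_def)
  qed
  have split: "u = 0 \<and> x = y \<or> (\<exists>v. u = v + 2 \<and> v < length (circles xs) \<and> circles xs ! v = (k, Cup x f))"
    if "u < length (circles (y # xs))" "circles (y # xs) ! u = (k, Cup x f)" for u k f
    using that by (cases u; cases "u - 1") auto
  have y: "y \<notin> set xs" using Cons.prems(1) by simp
  from split[OF Cons.prems(2,4)] split[OF Cons.prems(3,5)] show ?case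
  proof (elim disjE exE conjE)
    fix v v' assume "s = v + 2" "v < length (circles xs)" "circles xs ! v = (i, Cup x d)"
      "t = v' + 2" "v' < length (circles xs)" "circles xs ! v' = (j, Cup x e)"
    then show "s = t" using Cons.IH[of v v'] Cons.prems(1) by simp
  qed (use mem y in auto)
qed simp

text \<open>Two minima labelled 1 both lie in \<open>D\<close> and are joined through the base point
  \<open>P\<close>; two minima with any other common label are one and the same minimum of a
  circle.\<close>

lemma ordered_core_circles:
  assumes "run [] D = Some []" "labels D = {1}" "distinct xs" "insert 1 (set xs) = {1..m}" "1 \<notin> set xs"
    and D: "\<And>s i x d. s < length D \<Longrightarrow> D ! s = (i, Cup x d) \<Longrightarrow> same_component D P (s + 1, i)"
  shows "ordered_twisted_diagram (D @ circles xs)"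
proof (rule ordered_twisted_diagramI)
  show "twisted_diagram (D @ circles xs)"
    using assms(1) run_circles by (simp add: twisted_diagram_def run_append)
  show "labels (D @ circles xs) = {1..m}"
    using assms(2,4) by (simp add: labels_circles)
  fix s t i j x d e
  assume st: "s < length (D @ circles xs)" "t < length (D @ circles xs)"
    "(D @ circles xs) ! s = (i, Cup x d)" "(D @ circles xs) ! t = (j, Cup x e)"
  have left: "x = 1" if "u < length D" "D ! u = (k, Cup x f)" for u k f
    using assms(2) that nth_mem unfolding labels_def by fastforce
  have right: "x \<noteq> 1" if "u < length (circles xs)" "circles xs ! u = (k, Cup x f)" for u k f
    using assms(5) labels_circles[of xs] that nth_mem unfolding labels_def by fastforce
  show "same_component (D @ circles xs) (s + 1, i) (t + 1, j)"
  proof (cases "x = 1")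
    case True
    then have "s < length D" "t < length D"
      using st right[of "s - length D"] right[of "t - length D"] by (force simp: nth_append split: if_splits)+
    then have "same_component D P (s + 1, i)" "same_component D P (t + 1, j)"
      using st D by (auto simp: nth_append)
    then show ?thesis
      by (meson same_component_append same_component_sym same_component_trans)
  next
    case False
    then have "\<not> s < length D" "\<not> t < length D"
      using st left by (auto simp: nth_append)
    then have "s - length D = t - length D"
      using st by (intro circles_cup_unique[OF assms(3)]) (auto simp: nth_append)
    then have "s = t" using \<open>\<not> s < length D\<close> \<open>\<not> t < length D\<close> by linarith
    then show ?thesis using st by simp
  qed
qed

theorem theorem5p2:
  shows "\<exists>Dx Dy :: nat \<Rightarrow> nat word. \<forall>n\<ge>1.
    ordered_twisted_diagram (Dx n) \<and> ordered_twisted_diagram (Dy n) \<and>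
    \<not> twisted_equivalent (Dx n) (Dy n) \<and>
    \<not> twisted_equivalent (forget_labels (Dx n)) (forget_labels (Dy n)) \<and>
    virtual_equivalent (double_cover (Dx n)) (double_cover (Dy n)) \<and>
    virtual_equivalent (forget_labels (double_cover (Dx n))) (forget_labels (double_cover (Dy n))) \<and>
    (\<forall>n'\<ge>1. n \<noteq> n' \<longrightarrow>
       \<not> twisted_equivalent (Dx n) (Dx n') \<and> \<not> twisted_equivalent (Dx n) (Dy n') \<and>
       \<not> twisted_equivalent (Dy n) (Dx n') \<and> \<not> twisted_equivalent (Dy n) (Dy n'))"
proof -
  \<comment> \<open>The circle labels run from 2 to \<open>n + 1\<close>, continuing the label 1 of
    the knot as an ordered diagram requires.\<close>
  define Dx :: "nat \<Rightarrow> nat word" where "Dx n = core_x 1 @ circles [2..<n + 2]" for n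
  define Dy :: "nat \<Rightarrow> nat word" where "Dy n = core_y 1 @ circles [2..<n + 2]" for n
  have set: "insert 1 (set [2..<n + 2]) = {1..n + 1}" for n :: nat by auto
  have labels: "labels (Dx n) = {1..n + 1}" "labels (Dy n) = {1..n + 1}" for n
    using set[of n] by (simp_all add: Dx_def Dy_def labels_core labels_circles)
  have inj: "n = n'" if "{1..n + 1} = {1..n' + 1}" for n n' :: nat
    using arg_cong[OF that, of card] by simp
  have ordered: "ordered_twisted_diagram (Dx n)" "ordered_twisted_diagram (Dy n)" for n
    unfolding Dx_def Dy_def
    by (rule ordered_core_circles[OF run_core(1) labels_core(1) _ set _ core_cup_component(1)]; simp)
      (rule ordered_core_circles[OF run_core(2) labels_core(2) _ set _ core_cup_component(2)]; simp)
  show ?thesis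
  proof (rule exI[of _ Dx], rule exI[of _ Dy], intro allI impI conjI)
    fix n :: nat
    show "ordered_twisted_diagram (Dx n)" "ordered_twisted_diagram (Dy n)"
      by (fact ordered)+
    show "\<not> twisted_equivalent (Dx n) (Dy n)"
      "\<not> twisted_equivalent (forget_labels (Dx n)) (forget_labels (Dy n))"
      unfolding Dx_def Dy_def forget_labels_diagrams by (rule not_twisted_equivalent)+
    show "virtual_equivalent (double_cover (Dx n)) (double_cover (Dy n))"
      "virtual_equivalent (forget_labels (double_cover (Dx n))) (forget_labels (double_cover (Dy n)))"
      unfolding Dx_def Dy_def forget_labels_double_cover forget_labels_diagrams
      by (rule virtual_equivalent_covers)+
    fix n' :: nat assume "n \<noteq> n'"
    then show "\<not> twisted_equivalent (Dx n) (Dx n')" "\<not> twisted_equivalent (Dx n) (Dy n')"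
      "\<not> twisted_equivalent (Dy n) (Dx n')" "\<not> twisted_equivalent (Dy n) (Dy n')"
      using labels_invariant labels inj by metis+
  qed
qed

end
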